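(* Let $v$ be a Hamiltonian flow with finitely many singular points on a compact surface $S$. Then there is an arbitrarily small reparametrization $w$ of $v$ with respect to the compact-open topology such that the orbit space $S/v$ is homeomorphic to the abstract weak orbit space $S/[w_1]$ of the time-one map $w_1$ of $w$. That is, every neighborhood of $v$ in the set of flows on $S$ with the compact-open topology contains a reparametrization $w$ of $v$ such that $S/v$ is homeomorphic to $S/[w_1]$.
   Context: A flow on a space $X$ is a continuous $\mathbb{R}$-action $v:\mathbb{R}\times X\to X$; $O_v(x)$ is the orbit of $x$; the orbit space $X/v$ is the quotient space of $X$ collapsing each orbit to a point. A flow $w$ is a reparametrization of $v$ if $O_v(x)=O_w(x)$ for all $x\in X$. The time-one map is $w_1=w(1,\cdot)$. A vector field $Y$ on an orientable surface $S$ with volume form $\omega_S$ is Hamiltonian if $dH=\omega_S(Y,\cdot)$ for some $C^{r+1}$ function $H:S\to\mathbb{R}$ ($r\ge0$); a flow is Hamiltonian if it is topologically equivalent (via a homeomorphism mapping orbits to orbits and preserving direction) to the flow generated by a Hamiltonian vector field. Abstract weak orbits of a flow $u$ on a space $X$: $\omega(x)=\bigcap_{n\in\mathbb{R}}\overline{\{u_t(x): t>n\}}$, $\alpha(x)=\bigcap_{n\in\mathbb{R}}\overline{\{u_t(x): t<n\}}$, $\alpha'(x)=\alpha(x)\setminus O(x)$, $\omega'(x)=\omega(x)\setminus O(x)$. $\mathrm{Sing}(u)$, $\mathrm{Per}(u)$ are the sets of singular and periodic points, $\mathrm{Cl}(u)$ their union; $x$ is recurrent if $x\in\alpha(x)\cup\omega(x)$;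 $\mathrm{R}(u)$ is the set of recurrent points not in $\mathrm{Cl}(u)$; $\mathrm{P}(u)$ is the set of non-recurrent points. $[x]'$ is the connected component containing $x$ of $\{y:\alpha'(y)=\alpha'(x),\omega'(y)=\omega'(x)\}$; $[x]''$ is the connected component containing $x$ of $[x]'\cap Z$, where $Z$ is the one of $\mathrm{Sing}(u),\mathrm{Per}(u),\mathrm{P}(u),\mathrm{R}(u)$ containing $x$. The abstract weak orbit is $[x]_u=[x]''$ if $x\notin \mathrm{R}(u)$, and $[x]_u=\{y:\overline{O(y)}=\overline{O(x)},\alpha(y)=\alpha(x),\omega(y)=\omega(x)\}$ if $x\in\mathrm{R}(u)$. These partition $X$, and $X/[u]$ is the quotient space. For a homeomorphism $f:X\to X$, the mapping torus is $X_f=(X\times\mathbb{R})/\!\sim$ with $(x,t)\sim(f^n(x),t-n)$, $n\in\mathbb{Z}$, and the suspension flow is $v_f(t,[(x,s)])=[(x,t+s)]$. The abstract weak orbit of $x$ under $f$ is $[x]_f=\{y\in X: [(y,0)]\in [\,[(x,0)]\,]_{v_f}\}$, and $X/[f]$ is the quotient space of $X$ by the partition $\{[x]_f\}$; it is homeomorphic to $X_f/[v_f]$. *)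

theory Defs
  imports "HOL-Analysis.Analysis"
begin

section \<open>Quotient spaces\<close>

text \<open>The quotient of \<open>X\<close> by the fibres of \<open>q\<close>.  Below, \<open>q\<close> always sends a point to the member of
  a partition that contains it, so that the points of the quotient space are the members of the
  partition.\<close>

definition quotient_topology :: "'a topology \<Rightarrow> ('a \<Rightarrow> 'b) \<Rightarrow> 'b topology" where
  "quotient_topology X q =
     topology (\<lambda>V. V \<subseteq> q ` topspace X \<and> openin X {x \<in> topspace X. q x \<in> V})"

lemma istopology_quotient:
  "istopology (\<lambda>V. V \<subseteq> q ` topspace X \<and> openin X {x \<in> topspace X. q x \<in> V})"
proof -
  have 1: "{x \<in> topspace X. q x \<in> S \<inter> T} =
      {x \<in> topspace X. q x \<in> S} \<inter> {x \<in> topspace X. q x \<in> T}" for S T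
    by auto
  have 2: "{x \<in> topspace X. q x \<in> \<Union>\<K>} = (\<Union>K\<in>\<K>. {x \<in> topspace X. q x \<in> K})" for \<K>
    by auto
  show ?thesis
    unfolding istopology_def 1 2 by (auto simp: openin_Int)
qed

lemma openin_quotient_topology:
  "openin (quotient_topology X q) V \<longleftrightarrow>
     V \<subseteq> q ` topspace X \<and> openin X {x \<in> topspace X. q x \<in> V}"
  unfolding quotient_topology_def topology_inverse'[OF istopology_quotient] ..

lemma topspace_quotient_topology [simp]: "topspace (quotient_topology X q) = q ` topspace X"
proof -
  have "{x \<in> topspace X. q x \<in> q ` topspace X} = topspace X"
    by auto
  then have "openin (quotient_topology X q) (q ` topspace X)"
    by (simp add: openin_quotient_topology)
  then show ?thesis
    by (meson openin_quotient_topology openin_subset openin_topspace subset_antisym)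
qed

lemma quotient_map_quotient_topology: "quotient_map X (quotient_topology X q) q"
  unfolding quotient_map_def by (auto simp: openin_quotient_topology)


section \<open>Flows\<close>

text \<open>Only the values on \<open>UNIV \<times> topspace X\<close> of a flow are relevant.\<close>

definition flow :: "'a topology \<Rightarrow> (real \<times> 'a \<Rightarrow> 'a) \<Rightarrow> bool" where
  "flow X v \<longleftrightarrow>
     continuous_map (prod_topology euclideanreal X) X v \<and>
     (\<forall>x\<in>topspace X. v (0, x) = x) \<and>
     (\<forall>x\<in>topspace X. \<forall>s t. v (s + t, x) = v (s, v (t, x)))"

definition orbit :: "(real \<times> 'a \<Rightarrow> 'a) \<Rightarrow> 'a \<Rightarrow> 'a set" where
  "orbit v x = {v (t, x) | t. True}"

definition orbit_space :: "'a topology \<Rightarrow> (real \<times> 'a \<Rightarrow> 'a) \<Rightarrow> 'a set topology" where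
  "orbit_space X v = quotient_topology X (orbit v)"

definition reparametrization ::
    "'a topology \<Rightarrow> (real \<times> 'a \<Rightarrow> 'a) \<Rightarrow> (real \<times> 'a \<Rightarrow> 'a) \<Rightarrow> bool" where
  "reparametrization X v w \<longleftrightarrow> flow X w \<and> (\<forall>x\<in>topspace X. orbit v x = orbit w x)"

text \<open>The underlying set consists of all continuous maps (take \<open>K = {}\<close>).  Maps that agree on
  \<open>topspace X\<close> are not identified, but they belong to the same open sets.\<close>

definition compact_open_topology :: "'a topology \<Rightarrow> 'b topology \<Rightarrow> ('a \<Rightarrow> 'b) topology" where
  "compact_open_topology X Y =
     topology_generated_by
       {{f. continuous_map X Y f \<and> f ` K \<subseteq> U} | K U. compactin X K \<and> openin Y U}"

definition flow_topology :: "'a topology \<Rightarrow> (real \<times> 'a \<Rightarrow> 'a) topology" where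
  "flow_topology X =
     subtopology (compact_open_topology (prod_topology euclideanreal X) X) {v. flow X v}"

definition topologically_equivalent ::
    "'a topology \<Rightarrow> (real \<times> 'a \<Rightarrow> 'a) \<Rightarrow> (real \<times> 'a \<Rightarrow> 'a) \<Rightarrow> bool" where
  "topologically_equivalent X u v \<longleftrightarrow>
     (\<exists>h. homeomorphic_map X X h \<and>
       (\<forall>x\<in>topspace X.
          h ` orbit u x = orbit v (h x) \<and>
          (\<exists>\<tau>::real \<Rightarrow> real. continuous_on UNIV \<tau> \<and> strict_mono \<tau> \<and> surj \<tau> \<and>
             (\<forall>t. h (u (t, x)) = v (\<tau> t, h x)))))"


section \<open>Abstract weak orbits of a flow\<close>

definition omega_limit :: "'a topology \<Rightarrow> (real \<times> 'a \<Rightarrow> 'a) \<Rightarrow> 'a \<Rightarrow> 'a set" where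
  "omega_limit X u x = (\<Inter>n::real. X closure_of {u (t, x) | t. t > n})"

definition alpha_limit :: "'a topology \<Rightarrow> (real \<times> 'a \<Rightarrow> 'a) \<Rightarrow> 'a \<Rightarrow> 'a set" where
  "alpha_limit X u x = (\<Inter>n::real. X closure_of {u (t, x) | t. t < n})"

definition omega_limit' :: "'a topology \<Rightarrow> (real \<times> 'a \<Rightarrow> 'a) \<Rightarrow> 'a \<Rightarrow> 'a set" where
  "omega_limit' X u x = omega_limit X u x - orbit u x"

definition alpha_limit' :: "'a topology \<Rightarrow> (real \<times> 'a \<Rightarrow> 'a) \<Rightarrow> 'a \<Rightarrow> 'a set" where
  "alpha_limit' X u x = alpha_limit X u x - orbit u x"

definition Sing :: "'a topology \<Rightarrow> (real \<times> 'a \<Rightarrow> 'a) \<Rightarrow> 'a set" where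
  "Sing X u = {x \<in> topspace X. \<forall>t. u (t, x) = x}"

definition Per :: "'a topology \<Rightarrow> (real \<times> 'a \<Rightarrow> 'a) \<Rightarrow> 'a set" where
  "Per X u = {x \<in> topspace X. \<exists>T>0. u (T, x) = x \<and> (\<forall>t. 0 < t \<and> t < T \<longrightarrow> u (t, x) \<noteq> x)}"

definition Cl :: "'a topology \<Rightarrow> (real \<times> 'a \<Rightarrow> 'a) \<Rightarrow> 'a set" where
  "Cl X u = Sing X u \<union> Per X u"

definition recurrent :: "'a topology \<Rightarrow> (real \<times> 'a \<Rightarrow> 'a) \<Rightarrow> 'a \<Rightarrow> bool" where
  "recurrent X u x \<longleftrightarrow> x \<in> alpha_limit X u x \<union> omega_limit X u x"

definition Rec :: "'a topology \<Rightarrow> (real \<times> 'a \<Rightarrow> 'a) \<Rightarrow> 'a set" where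
  "Rec X u = {x \<in> topspace X. recurrent X u x} - Cl X u"

definition Nonrec :: "'a topology \<Rightarrow> (real \<times> 'a \<Rightarrow> 'a) \<Rightarrow> 'a set" where
  "Nonrec X u = {x \<in> topspace X. \<not> recurrent X u x}"

text \<open>The class \<open>[x]'\<close>.\<close>

definition weak_class' :: "'a topology \<Rightarrow> (real \<times> 'a \<Rightarrow> 'a) \<Rightarrow> 'a \<Rightarrow> 'a set" where
  "weak_class' X u x =
     connected_component_of_set
       (subtopology X {y \<in> topspace X. alpha_limit' X u y = alpha_limit' X u x \<and>
                                       omega_limit' X u y = omega_limit' X u x}) x"

definition orbit_stratum :: "'a topology \<Rightarrow> (real \<times> 'a \<Rightarrow> 'a) \<Rightarrow> 'a \<Rightarrow> 'a set" where
  "orbit_stratum X u x =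
     (if x \<in> Sing X u then Sing X u
      else if x \<in> Per X u then Per X u
      else if x \<in> Nonrec X u then Nonrec X u
      else Rec X u)"

text \<open>The class \<open>[x]''\<close>.\<close>

definition weak_class'' :: "'a topology \<Rightarrow> (real \<times> 'a \<Rightarrow> 'a) \<Rightarrow> 'a \<Rightarrow> 'a set" where
  "weak_class'' X u x =
     connected_component_of_set (subtopology X (weak_class' X u x \<inter> orbit_stratum X u x)) x"

definition weak_orbit :: "'a topology \<Rightarrow> (real \<times> 'a \<Rightarrow> 'a) \<Rightarrow> 'a \<Rightarrow> 'a set" where
  "weak_orbit X u x =
     (if x \<in> Rec X u
      then {y \<in> topspace X. X closure_of orbit u y = X closure_of orbit u x \<and>
                            alpha_limit X u y = alpha_limit X u x \<and>
                            omega_limit X u y = omega_limit X u x}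
      else weak_class'' X u x)"


section \<open>Abstract weak orbits of a homeomorphism\<close>

text \<open>\<open>f\<^sup>n\<close> for an integer \<open>n\<close>, where \<open>f\<close> is a homeomorphism of \<open>X\<close> onto itself.\<close>

definition int_iterate :: "'a topology \<Rightarrow> ('a \<Rightarrow> 'a) \<Rightarrow> int \<Rightarrow> 'a \<Rightarrow> 'a" where
  "int_iterate X f n =
     (if n \<ge> 0 then f ^^ nat n else inv_into (topspace X) f ^^ nat (- n))"

text \<open>The equivalence class \<open>[(x, t)]\<close> in the mapping torus.\<close>

definition torus_class :: "'a topology \<Rightarrow> ('a \<Rightarrow> 'a) \<Rightarrow> 'a \<times> real \<Rightarrow> ('a \<times> real) set" where
  "torus_class X f = (\<lambda>(x, t). {(int_iterate X f n x, t - of_int n) | n. True})"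

definition mapping_torus :: "'a topology \<Rightarrow> ('a \<Rightarrow> 'a) \<Rightarrow> ('a \<times> real) set topology" where
  "mapping_torus X f = quotient_topology (prod_topology X euclideanreal) (torus_class X f)"

text \<open>Translating all representatives of a class by \<open>t\<close> gives a class again, which is how the
  suspension flow acts; it does not mention \<open>f\<close>.\<close>

definition suspension_flow :: "real \<times> ('a \<times> real) set \<Rightarrow> ('a \<times> real) set" where
  "suspension_flow = (\<lambda>(t, c). (\<lambda>(x, s). (x, t + s)) ` c)"

lemma suspension_flow_torus_class:
  "suspension_flow (t, torus_class X f (x, s)) = torus_class X f (x, t + s)"
  unfolding suspension_flow_def torus_class_def by (force simp: algebra_simps)

definition map_weak_orbit :: "'a topology \<Rightarrow> ('a \<Rightarrow> 'a) \<Rightarrow> 'a \<Rightarrow> 'a set" where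
  "map_weak_orbit X f x =
     {y \<in> topspace X. torus_class X f (y, 0) \<in>
        weak_orbit (mapping_torus X f) suspension_flow (torus_class X f (x, 0))}"

definition map_weak_orbit_space :: "'a topology \<Rightarrow> ('a \<Rightarrow> 'a) \<Rightarrow> 'a set topology" where
  "map_weak_orbit_space X f = quotient_topology X (map_weak_orbit X f)"


section \<open>Surfaces and smooth structures\<close>

type_synonym plane = "real \<times> real"

type_synonym 'a chart = "'a set \<times> ('a \<Rightarrow> plane)"

definition half_plane :: "plane set" where
  "half_plane = {p. snd p \<ge> 0}"

definition chart :: "'a topology \<Rightarrow> 'a chart \<Rightarrow> bool" where
  "chart X = (\<lambda>(U, \<phi>).
     openin X U \<and> openin (top_of_set half_plane) (\<phi> ` U) \<and>
     homeomorphic_map (subtopology X U) (top_of_set (\<phi> ` U)) \<phi>)"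

text \<open>Surfaces may have a boundary and need not be connected.\<close>

definition surface :: "'a topology \<Rightarrow> bool" where
  "surface X \<longleftrightarrow>
     Hausdorff_space X \<and> second_countable X \<and>
     (\<forall>x\<in>topspace X. \<exists>U \<phi>. chart X (U, \<phi>) \<and> x \<in> U)"

text \<open>\<open>Ck_on k U f\<close> says that \<open>f\<close> is of class \<open>C\<^sup>k\<close> on \<open>U\<close>.  It is used only for sets \<open>U\<close>
  that are relatively open in the half plane, where derivatives within \<open>U\<close> are unique; at the
  boundary points of the half plane they are one-sided.\<close>

primrec Ck_on :: "nat \<Rightarrow> plane set \<Rightarrow> (plane \<Rightarrow> 'b::real_normed_vector) \<Rightarrow> bool" where
  "Ck_on 0 U f \<longleftrightarrow> continuous_on U f"
| "Ck_on (Suc k) U f \<longleftrightarrow>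
     (\<forall>p\<in>U. f differentiable (at p within U)) \<and>
     (\<forall>e. Ck_on k U (\<lambda>p. frechet_derivative f (at p within U) e))"

text \<open>The transition map \<open>\<psi> \<circ> \<phi>\<^sup>-\<^sup>1\<close> and its domain, for charts \<open>c = (U, \<phi>)\<close> and \<open>d = (V, \<psi>)\<close>.\<close>

definition transition :: "'a chart \<Rightarrow> 'a chart \<Rightarrow> plane \<Rightarrow> plane" where
  "transition c d = (\<lambda>p. snd d (inv_into (fst c) (snd c) p))"

definition overlap :: "'a chart \<Rightarrow> 'a chart \<Rightarrow> plane set" where
  "overlap c d = snd c ` (fst c \<inter> fst d)"

definition transition_deriv :: "'a chart \<Rightarrow> 'a chart \<Rightarrow> plane \<Rightarrow> plane \<Rightarrow> plane" where
  "transition_deriv c d p = frechet_derivative (transition c d) (at p within overlap c d)"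

definition smooth_atlas :: "'a topology \<Rightarrow> 'a chart set \<Rightarrow> bool" where
  "smooth_atlas X \<A> \<longleftrightarrow>
     (\<forall>c\<in>\<A>. chart X c) \<and> (\<Union>c\<in>\<A>. fst c) = topspace X \<and>
     (\<forall>c\<in>\<A>. \<forall>d\<in>\<A>. \<forall>k. Ck_on k (overlap c d) (transition c d))"


section \<open>Hamiltonian flows\<close>

text \<open>Tensor fields are given by their coordinate representations in the charts of an atlas,
  subject to the transformation law on overlaps.\<close>

definition area :: "plane \<Rightarrow> plane \<Rightarrow> real" where
  "area a b = fst a * snd b - snd a * fst b"

text \<open>The form is \<open>\<rho> c dx \<and> dy\<close> in the chart \<open>c\<close>.  Its existence makes the surface orientable.\<close>

definition volume_form :: "'a chart set \<Rightarrow> ('a chart \<Rightarrow> plane \<Rightarrow> real) \<Rightarrow> bool" where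
  "volume_form \<A> \<rho> \<longleftrightarrow>
     (\<forall>c\<in>\<A>. (\<forall>k. Ck_on k (snd c ` fst c) (\<rho> c)) \<and> (\<forall>p \<in> snd c ` fst c. \<rho> c p \<noteq> 0)) \<and>
     (\<forall>c\<in>\<A>. \<forall>d\<in>\<A>. \<forall>p \<in> overlap c d. \<forall>a b.
        \<rho> c p * area a b =
        \<rho> d (transition c d p) * area (transition_deriv c d p a) (transition_deriv c d p b))"

definition vector_field :: "nat \<Rightarrow> 'a chart set \<Rightarrow> ('a chart \<Rightarrow> plane \<Rightarrow> plane) \<Rightarrow> bool" where
  "vector_field r \<A> Y \<longleftrightarrow>
     (\<forall>c\<in>\<A>. Ck_on r (snd c ` fst c) (Y c)) \<and>
     (\<forall>c\<in>\<A>. \<forall>d\<in>\<A>. \<forall>p \<in> overlap c d.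
        Y d (transition c d p) = transition_deriv c d p (Y c p))"

definition in_chart :: "('a \<Rightarrow> real) \<Rightarrow> 'a chart \<Rightarrow> plane \<Rightarrow> real" where
  "in_chart H c = (\<lambda>p. H (inv_into (fst c) (snd c) p))"

definition hamiltonian_vector_field ::
    "nat \<Rightarrow> 'a chart set \<Rightarrow> ('a chart \<Rightarrow> plane \<Rightarrow> real) \<Rightarrow> ('a chart \<Rightarrow> plane \<Rightarrow> plane) \<Rightarrow> bool" where
  "hamiltonian_vector_field r \<A> \<rho> Y \<longleftrightarrow>
     vector_field r \<A> Y \<and>
     (\<exists>H. \<forall>c\<in>\<A>. Ck_on (Suc r) (snd c ` fst c) (in_chart H c) \<and>
        (\<forall>p \<in> snd c ` fst c. \<forall>e.
           frechet_derivative (in_chart H c) (at p within snd c ` fst c) e =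
           \<rho> c p * area (Y c p) e))"

definition generates ::
    "'a topology \<Rightarrow> 'a chart set \<Rightarrow> ('a chart \<Rightarrow> plane \<Rightarrow> plane) \<Rightarrow> (real \<times> 'a \<Rightarrow> 'a) \<Rightarrow> bool" where
  "generates X \<A> Y u \<longleftrightarrow>
     flow X u \<and>
     (\<forall>c\<in>\<A>. \<forall>x\<in>topspace X. \<forall>t. u (t, x) \<in> fst c \<longrightarrow>
        ((\<lambda>s. snd c (u (s, x))) has_vector_derivative Y c (snd c (u (t, x)))) (at t))"

definition hamiltonian_flow :: "'a topology \<Rightarrow> (real \<times> 'a \<Rightarrow> 'a) \<Rightarrow> bool" where
  "hamiltonian_flow X v \<longleftrightarrow>
     flow X v \<and>
     (\<exists>\<A> \<rho> r Y u.
        smooth_atlas X \<A> \<and> volume_form \<A> \<rho> \<and> hamiltonian_vector_field r \<A> \<rho> Y \<and>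
        generates X \<A> Y u \<and> topologically_equivalent X u v)"

end

theory Submission
  imports Defs
begin

text \<open>
  Let \<open>H\<close> be the Hamiltonian, transported to the flow \<open>v\<close>.  Near a nonsingular point, each level of
  \<open>H\<close> lies in one orbit.  (The vector field is only continuous and may vanish at nonsingular points,
  but it does not vanish along a whole nonsingular orbit, and \<open>v\<close> transports the local picture along
  the orbit.)  Hence a nonsingular orbit that is not periodic accumulates only on singular points.

  Let \<open>w (t, x) = v (exp (l * H x) * t, x)\<close> with a small constant \<open>l\<close>.  The mapping torus of \<open>w\<^sub>1\<close> is
  \<open>S \<times> S\<^sup>1\<close> with the flow \<open>w\<close> times a rotation, and the claim is that every weak orbit there is an orbit
  of \<open>w\<close> times \<open>S\<^sup>1\<close>.  Periodic orbits of irrational period give minimal tori, and nonperiodic orbits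
  are separated by the levels of \<open>H\<close>.  The remaining orbits, singular or of rational period,
  become periodic, and can only be joined to each other if they fill an open set of annuli on which the
  period is rational; each set of a countable base of the topology excludes at most one value of \<open>l\<close> in this way,
  so all but countably many \<open>l\<close> are good.
\<close>


section \<open>Flows and orbits\<close>

text \<open>Closed orbits carry no limit data: their primed limit sets are empty, so connectedness
  alone decides which of them are merged. The obstacle is therefore a continuum of closed orbits of
  the suspension, and \<open>v\<close> itself may produce one, for instance an annulus of constant
  rational period. Since \<open>v\<close> is only topologically equivalent to the flow of a vector
  field, its period need not be a differentiable function of the level, and no derivative of it is
  available to perturb such an annulus away. The factor \<open>exp (l * H x)\<close> works without
  regularity: it is positive for every \<open>l\<close>, so orbits are kept; it is constant along
  orbits, so the result is again a flow; it gives back \<open>v\<close> at \<open>l = 0\<close>; and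
  the factors of two exponents have the quotient \<open>exp ((l - l') * H x)\<close>, which is
  injective in the level when \<open>l \<noteq> l'\<close>.\<close>

lemma flow_zero: "flow X v \<Longrightarrow> x \<in> topspace X \<Longrightarrow> v (0, x) = x"
  by (simp add: flow_def)

lemma flow_add: "flow X v \<Longrightarrow> x \<in> topspace X \<Longrightarrow> v (s, v (t, x)) = v (s + t, x)"
  by (simp add: flow_def)

lemma flow_continuous_map: "flow X v \<Longrightarrow> continuous_map (prod_topology euclideanreal X) X v"
  by (simp add: flow_def)

lemma flow_in_topspace: "flow X v \<Longrightarrow> x \<in> topspace X \<Longrightarrow> v (t, x) \<in> topspace X"
  by (auto simp: flow_def continuous_map_def Pi_iff)

lemma flow_inverse: "flow X v \<Longrightarrow> x \<in> topspace X \<Longrightarrow> v (- t, v (t, x)) = x"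
  by (simp add: flow_add flow_zero)

lemma continuous_map_flow_compose:
  assumes "flow X v" "continuous_map Z euclideanreal f" "continuous_map Z X g"
  shows "continuous_map Z X (\<lambda>z. v (f z, g z))"
  using continuous_map_compose [OF _ flow_continuous_map [OF assms(1)], of Z "\<lambda>z. (f z, g z)"] assms(2,3)
  by (simp add: continuous_map_pairedI o_def)

lemma continuous_map_flow_time:
  "flow X v \<Longrightarrow> x \<in> topspace X \<Longrightarrow> continuous_map euclideanreal X (\<lambda>t. v (t, x))"
  using continuous_map_flow_compose [of X v euclideanreal "\<lambda>t. t" "\<lambda>_. x"] by simp

lemma continuous_map_flow_space: "flow X v \<Longrightarrow> continuous_map X X (\<lambda>x. v (t, x))"
  using continuous_map_flow_compose [of X v X "\<lambda>_. t" "\<lambda>x. x"] by simp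

lemma homeomorphic_map_flow:
  assumes "flow X v"
  shows "homeomorphic_map X X (\<lambda>x. v (t, x))"
proof -
  have "homeomorphic_maps X X (\<lambda>x. v (t, x)) (\<lambda>x. v (- t, x))"
    unfolding homeomorphic_maps_def
    using assms flow_inverse [OF assms, of _ t] flow_inverse [OF assms, of _ "- t"]
    by (auto simp: continuous_map_flow_space)
  then show ?thesis
    by (rule homeomorphic_maps_imp_map)
qed

lemma in_orbit_iff: "y \<in> orbit v x \<longleftrightarrow> (\<exists>t. y = v (t, x))"
  by (auto simp: orbit_def)

lemma orbit_eq_range: "orbit v x = range (\<lambda>t. v (t, x))"
  by (auto simp: orbit_def)

lemma orbit_subset_topspace: "flow X v \<Longrightarrow> x \<in> topspace X \<Longrightarrow> orbit v x \<subseteq> topspace X"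
  by (auto simp: orbit_def flow_in_topspace)

lemma self_in_orbit: "flow X v \<Longrightarrow> x \<in> topspace X \<Longrightarrow> x \<in> orbit v x"
  by (metis flow_zero in_orbit_iff)

lemma orbit_eq:
  assumes "flow X v" "x \<in> topspace X" "y \<in> orbit v x"
  shows "orbit v y = orbit v x"
proof -
  obtain t where t: "y = v (t, x)"
    using assms(3) by (auto simp: in_orbit_iff)
  have "v (s, y) = v (s + t, x)" "v (s, x) = v (s - t, y)" for s
    using assms t by (auto simp: flow_add)
  then show ?thesis
    unfolding orbit_def by (metis (no_types, opaque_lifting))
qed

lemma connectedin_orbit:
  assumes "flow X v" "x \<in> topspace X"
  shows "connectedin X (orbit v x)"
  unfolding orbit_eq_range
  using connectedin_continuous_map_image [OF continuous_map_flow_time [OF assms], of UNIV]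
  by simp

lemma Sing_in_topspace: "x \<in> Sing X v \<Longrightarrow> x \<in> topspace X"
  by (simp add: Sing_def)

lemma Sing_fixed: "x \<in> Sing X v \<Longrightarrow> v (t, x) = x"
  by (simp add: Sing_def)

lemma flow_notin_Sing:
  assumes "flow X v" "x \<in> topspace X" "x \<notin> Sing X v"
  shows "v (t, x) \<notin> Sing X v"
  using assms by (metis Sing_fixed flow_inverse)

lemma closed_periods:
  assumes "flow X v" "Hausdorff_space X" "x \<in> topspace X"
  shows "closed {t. v (t, x) = x}"
proof -
  have "closedin euclideanreal {t \<in> topspace euclideanreal. v (t, x) \<in> {x}}"
    using closedin_continuous_map_preimage [OF continuous_map_flow_time [OF assms(1,3)], of "{x}"] assms
    by (simp add: closedin_Hausdorff_singleton)
  then show ?thesis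
    by simp
qed


section \<open>Level boxes\<close>

text \<open>The clauses serve different ends: the first makes levels separate orbits locally, the
  bounded time \<open>M\<close> turns a visit to \<open>U\<close> on the level of \<open>x\<close>
  into an exact hit of \<open>x\<close> nearby in time, and the uncountable images allow exponents
  of the rescaling to be counted against the rationals.\<close>

definition level_box :: "'a topology \<Rightarrow> (real \<times> 'a \<Rightarrow> 'a) \<Rightarrow> ('a \<Rightarrow> real) \<Rightarrow> 'a \<Rightarrow> bool" where
  "level_box X v H x \<longleftrightarrow>
     (\<exists>U. openin X U \<and> x \<in> U \<and> (\<forall>y\<in>U. \<forall>z\<in>U. H y = H z \<longrightarrow> z \<in> orbit v y) \<and>
        (\<exists>M. \<forall>z\<in>U. H z = H x \<longrightarrow> (\<exists>s. \<bar>s\<bar> \<le> M \<and> z = v (s, x)))) \<and>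
     (\<forall>W. openin X W \<longrightarrow> x \<in> W \<longrightarrow> uncountable (H ` W))"

text \<open>Serves two purposes: with a time map of the flow itself it moves a box along an orbit,
  and with a topological equivalence it moves a box to another flow. A monotone
  \<open>\<tau>\<close> sends \<open>{- M..M}\<close> into \<open>{\<tau> (- M)..\<tau> M}\<close>,
  which supplies the new time bound.\<close>

lemma level_box_transport:
  assumes h: "homeomorphic_map X X' h"
    and par: "\<And>y. y \<in> topspace X \<Longrightarrow> \<exists>\<tau>::real \<Rightarrow> real. mono \<tau> \<and> (\<forall>t. h (u (t, y)) = v (\<tau> t, h y))"
    and H: "\<And>y. y \<in> topspace X \<Longrightarrow> H' (h y) = H y"
    and box: "level_box X u H x" and x: "x \<in> topspace X"
  shows "level_box X' v H' (h x)"
proof -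
  obtain U M where U: "openin X U" "x \<in> U"
    and orb: "\<And>y z. y \<in> U \<Longrightarrow> z \<in> U \<Longrightarrow> H y = H z \<Longrightarrow> z \<in> orbit u y"
    and M: "\<And>z. z \<in> U \<Longrightarrow> H z = H x \<Longrightarrow> \<exists>s. \<bar>s\<bar> \<le> M \<and> z = u (s, x)"
    and unc: "\<And>W. openin X W \<Longrightarrow> x \<in> W \<Longrightarrow> uncountable (H ` W)"
    using box unfolding level_box_def by metis
  have UX: "U \<subseteq> topspace X"
    using U(1) openin_subset by blast
  obtain \<tau> where \<tau>: "mono \<tau>" "\<And>t. h (u (t, x)) = v (\<tau> t, h x)"
    using par [OF x] by blast
  have U': "openin X' (h ` U)"
    using h U(1) UX homeomorphic_map_openness by blast
  have orb': "z \<in> orbit v y" if y: "y \<in> h ` U" and z: "z \<in> h ` U" and eq: "H' y = H' z" for y z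
  proof -
    obtain y0 z0 where y0: "y0 \<in> U" "y = h y0" and z0: "z0 \<in> U" "z = h z0"
      using y z by blast
    then have "H y0 = H z0"
      using eq H UX by (metis subsetD)
    then obtain t where t: "z0 = u (t, y0)"
      using orb y0 z0 by (auto simp: in_orbit_iff)
    obtain \<tau>' where "\<And>t. h (u (t, y0)) = v (\<tau>' t, h y0)"
      using par y0(1) UX by blast
    then show ?thesis
      using t y0 z0 by (auto simp: in_orbit_iff)
  qed
  have M': "\<exists>s. \<bar>s\<bar> \<le> max \<bar>\<tau> M\<bar> \<bar>\<tau> (- M)\<bar> \<and> z = v (s, h x)"
    if z: "z \<in> h ` U" and eq: "H' z = H' (h x)" for z
  proof -
    obtain z0 where z0: "z0 \<in> U" "z = h z0"
      using z by blast
    then have "H z0 = H x"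
      using eq H UX x by (metis subsetD)
    then obtain s where s: "\<bar>s\<bar> \<le> M" "z0 = u (s, x)"
      using M z0 by blast
    then have "\<tau> (- M) \<le> \<tau> s" "\<tau> s \<le> \<tau> M"
      by (auto intro!: monoD [OF \<tau>(1)])
    then have "\<bar>\<tau> s\<bar> \<le> max \<bar>\<tau> M\<bar> \<bar>\<tau> (- M)\<bar>"
      by linarith
    then show ?thesis
      using s(2) z0(2) \<tau>(2) by blast
  qed
  have unc': "uncountable (H' ` W)" if W: "openin X' W" "h x \<in> W" for W
  proof -
    have "openin X {y \<in> topspace X. h y \<in> W}"
      using W(1) h homeomorphic_imp_continuous_map openin_continuous_map_preimage by blast
    then have "uncountable (H ` {y \<in> topspace X. h y \<in> W})"
      using unc x W(2) by blast
    moreover have "H ` {y \<in> topspace X. h y \<in> W} \<subseteq> H' ` W"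
    proof (clarify)
      fix y assume "y \<in> topspace X" "h y \<in> W"
      then show "H y \<in> H' ` W"
        by (metis H imageI)
    qed
    ultimately show ?thesis
      using countable_subset by blast
  qed
  have "h x \<in> h ` U"
    using U(2) by blast
  moreover have "\<exists>M. \<forall>z\<in>h ` U. H' z = H' (h x) \<longrightarrow> (\<exists>s. \<bar>s\<bar> \<le> M \<and> z = v (s, h x))"
    using M' by blast
  ultimately show ?thesis
    unfolding level_box_def using U' orb' unc'
    by (intro conjI exI [of _ "h ` U"]) simp_all
qed

section \<open>Level boxes where the vector field does not vanish\<close>

lemma Ck_on_imp_continuous_on: "Ck_on k U f \<Longrightarrow> continuous_on U f"
  by (cases k) (auto simp: differentiable_imp_continuous_within continuous_on_eq_continuous_within)

lemma convex_half_plane: "convex half_plane"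
proof -
  have "half_plane = {p. (0, 1) \<bullet> p \<ge> 0}"
    by (auto simp: half_plane_def)
  then show ?thesis
    using convex_halfspace_ge [of 0 "(0, 1) :: plane"] by metis
qed

text \<open>\<open>area Y d = 0\<close> makes \<open>d\<close> parallel to \<open>Y\<close>, while
  \<open>d\<close> is orthogonal to \<open>P\<close> and \<open>Y\<close> is not.\<close>

lemma planar_directions_independent:
  fixes Y P d :: plane
  assumes "area Y d = 0" "d \<bullet> P = 0" "Y \<bullet> P \<noteq> 0"
  shows "d = 0"
proof -
  obtain a b where Y: "Y = (a, b)" by (cases Y)
  obtain p q where P: "P = (p, q)" by (cases P)
  obtain s t where d: "d = (s, t)" by (cases d)
  have 1: "a * t - b * s = 0" and 2: "s * p + t * q = 0" and 3: "a * p + b * q \<noteq> 0"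
    using assms by (auto simp: Y P d area_def algebra_simps)
  have "t * (a * p + b * q) = 0" "s * (a * p + b * q) = 0"
    using 1 2 by algebra+
  then show ?thesis
    using 3 by (simp add: d zero_prod_def)
qed

text \<open>Along a segment perpendicular to \<open>P\<close> the derivative of \<open>g\<close> cannot vanish when \<open>Y \<bullet> P > 0\<close>.\<close>

lemma inj_on_transversal:
  fixes g :: "plane \<Rightarrow> real"
  assumes "convex B"
    and der: "\<And>q. q \<in> B \<Longrightarrow> (g has_derivative (\<lambda>e. \<rho> q * area (Y q) e)) (at q within B)"
    and nz: "\<And>q. q \<in> B \<Longrightarrow> \<rho> q \<noteq> 0" and pos: "\<And>q. q \<in> B \<Longrightarrow> Y q \<bullet> P > 0"
    and q: "q \<in> B" "q' \<in> B" and eq: "q \<bullet> P = q' \<bullet> P" "g q = g q'"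
  shows "q = q'"
proof -
  define \<gamma> where "\<gamma> = (\<lambda>s::real. q + s *\<^sub>R (q' - q))"
  have \<gamma>B: "\<gamma> ` {0..1} \<subseteq> B"
  proof (rule image_subsetI)
    fix s :: real assume s: "s \<in> {0..1}"
    have "\<gamma> s = (1 - s) *\<^sub>R q + s *\<^sub>R q'"
      by (simp add: \<gamma>_def algebra_simps)
    then show "\<gamma> s \<in> B"
      using assms(1) q s by (simp add: convexD_alt)
  qed
  have "((\<lambda>s. g (\<gamma> s)) has_derivative (\<lambda>h. \<rho> (\<gamma> s) * area (Y (\<gamma> s)) (h *\<^sub>R (q' - q)))) (at s within {0..1})"
    if s: "0 \<le> s" "s \<le> 1" for s
  proof -
    have "\<gamma> s \<in> B"
      using \<gamma>B s by auto
    then have 1: "(g has_derivative (\<lambda>e. \<rho> (\<gamma> s) * area (Y (\<gamma> s)) e)) (at (\<gamma> s) within \<gamma> ` {0..1})"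
      using der has_derivative_subset \<gamma>B by blast
    have 2: "(\<gamma> has_derivative (\<lambda>h. h *\<^sub>R (q' - q))) (at s within {0..1})"
      unfolding \<gamma>_def by (auto intro!: derivative_eq_intros)
    show ?thesis
      using diff_chain_within [OF 2 1] by (simp add: o_def)
  qed
  then obtain s where s: "s \<in> {0<..<1}"
    and "g (\<gamma> 1) - g (\<gamma> 0) = \<rho> (\<gamma> s) * area (Y (\<gamma> s)) ((1 - 0) *\<^sub>R (q' - q))"
    using mvt_simple [of 0 1 "\<lambda>s. g (\<gamma> s)"
        "\<lambda>s h. \<rho> (\<gamma> s) * area (Y (\<gamma> s)) (h *\<^sub>R (q' - q))"] zero_less_one by blast
  then have "\<rho> (\<gamma> s) * area (Y (\<gamma> s)) (q' - q) = 0"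
    using eq(2) by (simp add: \<gamma>_def)
  moreover have "\<gamma> s \<in> B"
    using \<gamma>B s by auto
  ultimately have "area (Y (\<gamma> s)) (q' - q) = 0" "Y (\<gamma> s) \<bullet> P \<noteq> 0"
    using nz pos [of "\<gamma> s"] by auto
  moreover have "(q' - q) \<bullet> P = 0"
    using eq(1) by (simp add: inner_diff_left)
  ultimately show ?thesis
    using planar_directions_independent by (metis eq_iff_diff_eq_0)
qed


text \<open>A flow box for a field that is merely continuous. With \<open>P = Y (\<phi> x)\<close>,
  points near \<open>x\<close> move along \<open>P\<close> with speed above \<open>m\<close>, so the
  flow reaches every nearby line orthogonal to \<open>P\<close> in bounded time; on such a line
  \<open>g\<close> is injective, so equal level forces equal point. Neither uniqueness of solutions
  nor a smooth straightening is involved. Boundary points are covered as well, because a ball cut by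
  the half plane is still convex.\<close>

lemma level_box_regular:
  fixes X :: "'a topology" and g :: "plane \<Rightarrow> real"
  assumes u: "flow X u" and ch: "chart X (U, \<phi>)"
    and Ycont: "continuous_on (\<phi> ` U) Y"
    and der: "\<And>q. q \<in> \<phi> ` U \<Longrightarrow> (g has_derivative (\<lambda>e. \<rho> q * area (Y q) e)) (at q within \<phi> ` U)"
    and nz: "\<And>q. q \<in> \<phi> ` U \<Longrightarrow> \<rho> q \<noteq> 0"
    and Hg: "\<And>y. y \<in> U \<Longrightarrow> H y = g (\<phi> y)"
    and inv: "\<And>t y. y \<in> topspace X \<Longrightarrow> H (u (t, y)) = H y"
    and gen: "\<And>t y. y \<in> topspace X \<Longrightarrow> u (t, y) \<in> U \<Longrightarrow>
      ((\<lambda>s. \<phi> (u (s, y))) has_vector_derivative Y (\<phi> (u (t, y)))) (at t)"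
    and x: "x \<in> U" and Yx: "Y (\<phi> x) \<noteq> 0"
  shows "level_box X u H x"
proof -
  define D where "D = \<phi> ` U"
  have opU: "openin X U" and opD: "openin (top_of_set half_plane) D"
    and hom: "homeomorphic_map (subtopology X U) (top_of_set D) \<phi>"
    using ch by (auto simp: chart_def D_def)
  have Dh: "D \<subseteq> half_plane"
    using openin_subset [OF opD] by simp
  have UX: "U \<subseteq> topspace X"
    using opU openin_subset by blast
  have inj: "inj_on \<phi> U"
    using homeomorphic_imp_injective_map [OF hom] UX by (simp add: Int_absorb1)
  have \<phi>cont: "continuous_map (subtopology X U) (top_of_set D) \<phi>"
    using hom homeomorphic_imp_continuous_map by blast
  have preim: "openin X {y \<in> U. \<phi> y \<in> V}" if "open V" for V
  proof -
    have "openin (subtopology X U) {y \<in> topspace (subtopology X U). \<phi> y \<in> D \<inter> V}"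
      using \<phi>cont that openin_continuous_map_preimage openin_open_Int by blast
    moreover have "{y \<in> topspace (subtopology X U). \<phi> y \<in> D \<inter> V} = {y \<in> U. \<phi> y \<in> V}"
      using UX by (auto simp: D_def)
    ultimately show ?thesis
      using openin_trans_full [OF _ opU] by simp
  qed
  define p where "p = \<phi> x"
  define P where "P = Y p"
  have pD: "p \<in> D"
    using x by (simp add: p_def D_def)
  define m where "m = (P \<bullet> P) / 2"
  have m: "m > 0" "P \<bullet> P > m"
    using Yx by (auto simp: m_def P_def p_def)
  obtain r1 where r1: "r1 > 0" "ball p r1 \<inter> half_plane \<subseteq> D"
    using opD pD by (metis openin_contains_ball)
  have "continuous_on D (\<lambda>q. Y q \<bullet> P)"
    using Ycont unfolding D_def by (intro continuous_intros)
  then obtain r2 where r2: "r2 > 0" "\<And>q. q \<in> D \<Longrightarrow> dist q p < r2 \<Longrightarrow> dist (Y q \<bullet> P) (Y p \<bullet> P) < m"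
    using pD m(1) unfolding continuous_on_iff by blast
  define r where "r = min r1 r2"
  define B where "B = ball p r \<inter> half_plane"
  have r0: "r > 0" and pB: "p \<in> B"
    using r1 r2 pD Dh by (auto simp: r_def B_def)
  have BD: "B \<subseteq> D"
    using r1 by (auto simp: B_def r_def)
  have DB: "q \<in> B" if "q \<in> D" "dist p q < r" for q
    using that Dh by (auto simp: B_def)
  have convB: "convex B"
    unfolding B_def using convex_half_plane by (simp add: convex_Int)
  have pos: "Y q \<bullet> P > m" if "q \<in> B" for q
  proof -
    have "dist (Y q \<bullet> P) (Y p \<bullet> P) < m"
      using that BD by (intro r2(2)) (auto simp: B_def r_def dist_commute)
    then show ?thesis
      by (auto simp: P_def [symmetric] m_def dist_real_def field_simps abs_if split: if_splits)
  qed
  have injB: "q = q'" if "q \<in> B" "q' \<in> B" "q \<bullet> P = q' \<bullet> P" "g q = g q'" for q q'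
  proof (rule inj_on_transversal [OF convB _ _ _ that])
    show "(g has_derivative (\<lambda>e. \<rho> q * area (Y q) e)) (at q within B)" if "q \<in> B" for q
      by (rule has_derivative_subset [OF der BD [unfolded D_def]]) (use that BD D_def in blast)
    show "\<rho> q \<noteq> 0" if "q \<in> B" for q
      using nz [of q] BD that unfolding D_def by blast
    show "Y q \<bullet> P > 0" if "q \<in> B" for q
      using pos [OF that] m(1) by linarith
  qed
  define U0 where "U0 = {y \<in> U. \<phi> y \<in> ball p r}"
  have U0: "openin X U0" "x \<in> U0" "U0 \<subseteq> U"
    using preim [of "ball p r"] x r0 by (auto simp: U0_def p_def)
  have U0B: "\<phi> y \<in> B" if "y \<in> U0" for y
    using that DB by (auto simp: U0_def D_def)
  have "openin (prod_topology euclideanreal X) {z \<in> topspace (prod_topology euclideanreal X). u z \<in> U0}"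
    using openin_continuous_map_preimage [OF flow_continuous_map [OF u] U0(1)] .
  moreover have "(0, x) \<in> {z \<in> topspace (prod_topology euclideanreal X). u z \<in> U0}"
    using flow_zero [OF u] U0 UX x by auto
  ultimately obtain T U1 where T: "open T" "0 \<in> T" and U1: "openin X U1" "x \<in> U1"
    and TU: "T \<times> U1 \<subseteq> {z \<in> topspace (prod_topology euclideanreal X). u z \<in> U0}"
    unfolding openin_prod_topology_alt open_openin [symmetric] by (elim allE impE) blast+
  \<comment> \<open>A time for which all of \<open>U1\<close> stays inside \<open>U0\<close>,
    forwards and backwards.\<close>
  obtain e where e: "e > 0" "cball 0 e \<subseteq> T"
    using T open_contains_cball by blast
  have stay: "u (t, y) \<in> U0" if "\<bar>t\<bar> \<le> e" "y \<in> U1" for t y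
    using TU e that by (auto simp: subset_iff)
  have U1X: "U1 \<subseteq> topspace X"
    using U1 openin_subset by blast
  have reach: "\<exists>s. \<bar>s\<bar> \<le> e \<and> \<phi> (u (s, y)) \<bullet> P = c"
    if y: "y \<in> U1" and c: "\<bar>c - \<phi> y \<bullet> P\<bar> < e * m" for y c
  proof -
    define k where "k = (\<lambda>t. \<phi> (u (t, y)) \<bullet> P)"
    have dk: "(k has_real_derivative Y (\<phi> (u (t, y))) \<bullet> P) (at t)" if "\<bar>t\<bar> \<le> e" for t
    proof -
      have "u (t, y) \<in> U"
        using stay [OF that y] U0(3) by blast
      then have "((\<lambda>s. \<phi> (u (s, y))) has_vector_derivative Y (\<phi> (u (t, y)))) (at t)"
        using gen y U1X by blast
      then have "((\<lambda>s. \<phi> (u (s, y)) \<bullet> P) has_derivative (\<lambda>h. (h *\<^sub>R Y (\<phi> (u (t, y)))) \<bullet> P)) (at t)"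
        unfolding has_vector_derivative_def by (rule has_derivative_inner_left)
      then show ?thesis
        by (simp add: k_def has_field_derivative_def mult_commute_abs)
    qed
    have big: "Y (\<phi> (u (t, y))) \<bullet> P > m" if "\<bar>t\<bar> \<le> e" for t
      using pos U0B stay that y by blast
    have kc: "continuous_on {-e..e} k"
      by (intro continuous_at_imp_continuous_on ballI DERIV_isCont [OF dk]) auto
    have mve: "e * m \<le> e * (Y (\<phi> (u (l, y))) \<bullet> P)" if "\<bar>l\<bar> \<le> e" for l
      using big [OF that] e(1) by (intro mult_left_mono) auto
    obtain l where l: "-e < l" "l < 0" "k 0 - k (-e) = (0 - (-e)) * (Y (\<phi> (u (l, y))) \<bullet> P)"
      using MVT2 [of "-e" 0 k "\<lambda>l. Y (\<phi> (u (l, y))) \<bullet> P"] e(1) dk by auto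
    have lo: "k (-e) \<le> k 0 - e * m"
    proof -
      have "\<bar>l\<bar> \<le> e"
        using l by auto
      from mve [OF this] l(3) show ?thesis
        by simp
    qed
    obtain l' where l': "0 < l'" "l' < e" "k e - k 0 = (e - 0) * (Y (\<phi> (u (l', y))) \<bullet> P)"
      using MVT2 [of 0 e k "\<lambda>l. Y (\<phi> (u (l, y))) \<bullet> P"] e(1) dk by auto
    have hi: "k e \<ge> k 0 + e * m"
    proof -
      have "\<bar>l'\<bar> \<le> e"
        using l' by auto
      from mve [OF this] l'(3) show ?thesis
        by simp
    qed
    have "k 0 = \<phi> y \<bullet> P"
      using flow_zero [OF u] y U1X by (auto simp: k_def)
    then have "k (-e) \<le> c" "c \<le> k e"
      using lo hi c by linarith+
    then obtain s where "-e \<le> s" "s \<le> e" "k s = c"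
      using IVT' [of k "-e" c e] kc e(1) by auto
    then show ?thesis
      by (intro exI [of _ s]) (auto simp: k_def)
  qed
  \<comment> \<open>Half of \<open>e * m\<close>, so that the \<open>P\<close>-coordinates of two
    points of \<open>U2\<close> differ by less than \<open>e * m\<close>, which the flow covers
    within time \<open>e\<close>.\<close>
  define U2 where "U2 = U1 \<inter> {y \<in> U. \<phi> y \<in> {q. \<bar>q \<bullet> P - p \<bullet> P\<bar> < e * m / 2}} \<inter> U0"
  have "open {q. \<bar>q \<bullet> P - p \<bullet> P\<bar> < e * m / 2}"
    by (intro open_Collect_less continuous_intros)
  then have opU2: "openin X U2"
    unfolding U2_def using preim U1 U0 by blast
  have xU2: "x \<in> U2"
    using x U1 U0 m e by (auto simp: U2_def p_def)
  have conn: "\<exists>s. \<bar>s\<bar> \<le> e \<and> z = u (s, y)" if y: "y \<in> U2" and z: "z \<in> U2" and eq: "H y = H z" for y z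
  proof -
    have "\<bar>\<phi> z \<bullet> P - \<phi> y \<bullet> P\<bar> < e * m"
    proof -
      have "\<bar>\<phi> y \<bullet> P - p \<bullet> P\<bar> < e * m / 2" "\<bar>\<phi> z \<bullet> P - p \<bullet> P\<bar> < e * m / 2"
        using y z by (auto simp: U2_def)
      then show ?thesis
        by linarith
    qed
    then obtain s where s: "\<bar>s\<bar> \<le> e" "\<phi> (u (s, y)) \<bullet> P = \<phi> z \<bullet> P"
      using reach y by (auto simp: U2_def)
    have us: "u (s, y) \<in> U0" and zU: "z \<in> U0" and yX: "y \<in> topspace X"
      using stay s y z U1X by (auto simp: U2_def)
    have "g (\<phi> (u (s, y))) = g (\<phi> z)"
      using Hg inv [OF yX] eq us zU U0(3) by (metis subsetD)
    then have "\<phi> (u (s, y)) = \<phi> z"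
      using injB U0B us zU s by blast
    then show ?thesis
      using inj us zU U0(3) s(1) by (metis inj_onD subsetD)
  qed
  have unc: "uncountable (H ` W)" if W: "openin X W" "x \<in> W" for W
  proof -
    have "openin (subtopology X U) (W \<inter> U0)"
      using W(1) U0 opU by (simp add: openin_open_subtopology openin_Int le_infI2)
    then have "openin (top_of_set D) (\<phi> ` (W \<inter> U0))"
      using hom homeomorphic_map_openness_eq by blast
    then have "openin (top_of_set half_plane) (\<phi> ` (W \<inter> U0))"
      using opD openin_trans by blast
    moreover have "p \<in> \<phi> ` (W \<inter> U0)"
      using W U0 by (auto simp: p_def)
    ultimately obtain r' where r': "r' > 0" "ball p r' \<inter> half_plane \<subseteq> \<phi> ` (W \<inter> U0)"
      by (metis openin_contains_ball)
    \<comment> \<open>A vector orthogonal to \<open>P\<close> with nonnegative second coordinate, so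
      that the segment starting at \<open>p\<close> stays in the half plane even if \<open>p\<close>
      lies on its edge.\<close>
    define d where "d = (if fst P \<ge> 0 then (- snd P, fst P) else (snd P, - fst P))"
    have d: "d \<bullet> P = 0" "snd d \<ge> 0" "d \<noteq> 0"
      using Yx by (auto simp: d_def P_def p_def inner_prod_def prod_eq_iff)
    define \<sigma> where "\<sigma> = r' / (2 * norm d)"
    have \<sigma>: "\<sigma> > 0"
      using d r' by (simp add: \<sigma>_def)
    define \<gamma> where "\<gamma> = (\<lambda>s::real. p + s *\<^sub>R d)"
    have \<gamma>W: "\<gamma> ` {0..\<sigma>} \<subseteq> \<phi> ` (W \<inter> U0)"
    proof -
      have "\<gamma> s \<in> ball p r' \<inter> half_plane" if "0 \<le> s" "s \<le> \<sigma>" for s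
      proof -
        have "norm (s *\<^sub>R d) \<le> \<sigma> * norm d"
          using that by (simp add: mult_right_mono)
        also have "\<dots> < r'"
          using r' d by (simp add: \<sigma>_def)
        finally show ?thesis
          using that d pB by (simp add: \<gamma>_def dist_norm half_plane_def B_def)
      qed
      then show ?thesis
        using r' by auto
    qed
    have WB: "\<phi> ` (W \<inter> U0) \<subseteq> B"
      using U0B by auto
    have gc: "continuous_on D g"
      using der unfolding D_def by (meson continuous_on_eq_continuous_within has_derivative_continuous)
    have "continuous_on {0..\<sigma>} (\<lambda>s. g (\<gamma> s))"
      using \<gamma>W WB BD by (intro continuous_on_compose2 [OF gc]) (auto simp: \<gamma>_def intro!: continuous_intros)
    then have "connected ((\<lambda>s. g (\<gamma> s)) ` {0..\<sigma>})"
      by (rule connected_continuous_image) simp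
    moreover have "g (\<gamma> 0) \<noteq> g (\<gamma> \<sigma>)"
    proof
      assume "g (\<gamma> 0) = g (\<gamma> \<sigma>)"
      moreover have "\<gamma> 0 \<in> B" "\<gamma> \<sigma> \<in> B"
        using \<gamma>W WB \<sigma> by (auto intro!: subsetD [OF WB] subsetD [OF \<gamma>W] imageI simp del: image_subset_iff)
      moreover have "\<gamma> 0 \<bullet> P = \<gamma> \<sigma> \<bullet> P"
        by (simp add: \<gamma>_def inner_add_left d)
      ultimately have "\<gamma> 0 = \<gamma> \<sigma>"
        using injB by blast
      then show False
        using d \<sigma> by (simp add: \<gamma>_def)
    qed
    ultimately have "uncountable ((\<lambda>s. g (\<gamma> s)) ` {0..\<sigma>})"
      using \<sigma> by (intro connected_uncountable [of _ "g (\<gamma> 0)" "g (\<gamma> \<sigma>)"]) auto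
    moreover have "(\<lambda>s. g (\<gamma> s)) ` {0..\<sigma>} \<subseteq> H ` W"
    proof (rule image_subsetI)
      fix s assume "s \<in> {0..\<sigma>}"
      then obtain y where "y \<in> W \<inter> U0" "\<gamma> s = \<phi> y"
        using \<gamma>W by blast
      then show "g (\<gamma> s) \<in> H ` W"
        using Hg U0(3) by (metis IntD1 IntD2 imageI subsetD)
    qed
    ultimately show ?thesis
      using countable_subset by blast
  qed
  have orb: "z \<in> orbit u y" if "y \<in> U2" "z \<in> U2" "H y = H z" for y z
    using conn [OF that] by (auto simp: in_orbit_iff)
  moreover have "\<exists>M. \<forall>z\<in>U2. H z = H x \<longrightarrow> (\<exists>s. \<bar>s\<bar> \<le> M \<and> z = u (s, x))"
    using conn [OF xU2] by metis
  ultimately show ?thesis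
    unfolding level_box_def using opU2 xU2 unc
    by (intro conjI exI [of _ U2]) simp_all
qed

text \<open>The times that bring \<open>x\<close> back to itself form an open set by local constancy
  and a closed one by the Hausdorff property, and they include 0.\<close>

lemma constant_of_locally_constant_flow:
  assumes u: "flow X u" and X: "Hausdorff_space X" and x: "x \<in> topspace X"
    and loc: "\<And>t. \<exists>d>0. \<forall>s. \<bar>s - t\<bar> < d \<longrightarrow> u (s, x) = u (t, x)"
  shows "x \<in> Sing X u"
proof -
  define T where "T = {t. u (t, x) = x}"
  have "open T"
    unfolding open_dist
  proof
    fix t assume t: "t \<in> T"
    obtain d where "d > 0" "\<And>s. \<bar>s - t\<bar> < d \<Longrightarrow> u (s, x) = u (t, x)"
      using loc by blast
    then have "s \<in> T" if "dist s t < d" for s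
      using t that unfolding T_def dist_real_def mem_Collect_eq by metis
    then show "\<exists>e>0. \<forall>y. dist y t < e \<longrightarrow> y \<in> T"
      using \<open>d > 0\<close> by blast
  qed
  moreover have "closed T"
    unfolding T_def by (rule closed_periods [OF u X x])
  moreover have "0 \<in> T"
    using flow_zero [OF u x] by (simp add: T_def)
  ultimately have "T = UNIV"
    using clopen [of T] by auto
  then show ?thesis
    using x by (auto simp: Sing_def T_def)
qed

section \<open>From charts to the surface, and from the generated flow to \<open>v\<close>\<close>

lemma chart_openin: "chart X c \<Longrightarrow> openin X (fst c)"
  by (cases c) (simp add: chart_def)

lemma chart_homeomorphic_map:
  "chart X c \<Longrightarrow> homeomorphic_map (subtopology X (fst c)) (top_of_set (snd c ` fst c)) (snd c)"
  by (cases c) (simp add: chart_def)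

lemma chart_inj_on:
  assumes "chart X c"
  shows "inj_on (snd c) (fst c)"
proof -
  have "topspace (subtopology X (fst c)) = fst c"
    using chart_openin [OF assms] openin_subset by (fastforce simp: Int_absorb1)
  then show ?thesis
    using homeomorphic_imp_injective_map [OF chart_homeomorphic_map [OF assms]] by simp
qed

lemma continuous_map_of_charts:
  assumes A: "smooth_atlas X \<A>"
    and cont: "\<And>c. c \<in> \<A> \<Longrightarrow> continuous_on (snd c ` fst c) (in_chart H c)"
  shows "continuous_map X euclideanreal H"
proof -
  have ch: "chart X c" if "c \<in> \<A>" for c
    using A that by (auto simp: smooth_atlas_def)
  show ?thesis
  proof (rule pasting_lemma [where I = \<A> and T = fst and f = "\<lambda>_. H"])
    fix c assume c: "c \<in> \<A>"
    have "continuous_map (top_of_set (snd c ` fst c)) euclideanreal (in_chart H c)"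
      unfolding continuous_map_iff_continuous by (rule cont [OF c])
    then have "continuous_map (subtopology X (fst c)) euclideanreal (in_chart H c \<circ> snd c)"
      by (rule continuous_map_compose [OF homeomorphic_imp_continuous_map [OF chart_homeomorphic_map [OF ch [OF c]]]])
    then show "continuous_map (subtopology X (fst c)) euclideanreal H"
      by (rule continuous_map_eq) (use chart_inj_on [OF ch [OF c]] in \<open>auto simp: in_chart_def\<close>)
  next
    fix x assume "x \<in> topspace X"
    then show "\<exists>c. c \<in> \<A> \<and> x \<in> fst c \<and> H x = H x"
      using A unfolding smooth_atlas_def by blast
  qed (use ch chart_openin in blast)+
qed

text \<open>Along an orbit of \<open>u\<close> the derivative of \<open>H\<close> is a multiple of
  \<open>area Y Y = 0\<close>. The conclusions are purely topological because the equivalence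
  between \<open>u\<close> and \<open>v\<close> is only a homeomorphism.\<close>

lemma hamiltonian_flow_level_structure:
  assumes X: "Hausdorff_space X" and ham: "hamiltonian_flow X v"
  obtains H where "continuous_map X euclideanreal H"
    "\<And>t x. x \<in> topspace X \<Longrightarrow> H (v (t, x)) = H x"
    "\<And>x. x \<in> topspace X \<Longrightarrow> x \<notin> Sing X v \<Longrightarrow> level_box X v H x"
proof -
  obtain \<A> \<rho> r Y u where A: "smooth_atlas X \<A>" and vol: "volume_form \<A> \<rho>"
    and hvf: "hamiltonian_vector_field r \<A> \<rho> Y" and gen: "generates X \<A> Y u"
    and equ: "topologically_equivalent X u v" and v: "flow X v"
    using ham unfolding hamiltonian_flow_def by blast
  obtain H where HCk: "\<And>c. c \<in> \<A> \<Longrightarrow> Ck_on (Suc r) (snd c ` fst c) (in_chart H c)"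
    and HY: "\<And>c p e. c \<in> \<A> \<Longrightarrow> p \<in> snd c ` fst c \<Longrightarrow>
      frechet_derivative (in_chart H c) (at p within snd c ` fst c) e = \<rho> c p * area (Y c p) e"
    using hvf unfolding hamiltonian_vector_field_def by blast
  have u: "flow X u"
    using gen by (simp add: generates_def)
  have ch: "chart X c" if "c \<in> \<A>" for c
    using A that by (auto simp: smooth_atlas_def)
  have inj: "inj_on (snd c) (fst c)" and op: "openin X (fst c)" if "c \<in> \<A>" for c
    using ch [OF that] by (auto intro: chart_inj_on chart_openin)
  have Hc: "H y = in_chart H c (snd c y)" if "c \<in> \<A>" "y \<in> fst c" for c y
    using inj that by (simp add: in_chart_def)
  have der: "(in_chart H c has_derivative (\<lambda>e. \<rho> c p * area (Y c p) e)) (at p within snd c ` fst c)"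
    if c: "c \<in> \<A>" and p: "p \<in> snd c ` fst c" for c p
  proof -
    have "in_chart H c differentiable (at p within snd c ` fst c)"
      using HCk [OF c] p unfolding Ck_on.simps by blast
    moreover have "frechet_derivative (in_chart H c) (at p within snd c ` fst c) = (\<lambda>e. \<rho> c p * area (Y c p) e)"
      using HY [OF c p] by blast
    ultimately show ?thesis
      unfolding frechet_derivative_works by simp
  qed
  have covering: "\<exists>c\<in>\<A>. y \<in> fst c" if "y \<in> topspace X" for y
    using A that unfolding smooth_atlas_def by blast
  have vd: "((\<lambda>s. snd c (u (s, y))) has_vector_derivative Y c (snd c (u (t, y)))) (at t)"
    if "c \<in> \<A>" "y \<in> topspace X" "u (t, y) \<in> fst c" for c y t
    using gen that by (auto simp: generates_def)
  have nearby: "\<exists>d>0. \<forall>s. \<bar>s - t\<bar> < d \<longrightarrow> u (s, y) \<in> V"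
    if "y \<in> topspace X" "openin X V" "u (t, y) \<in> V" for y t V
  proof -
    have "open {s. u (s, y) \<in> V}"
      using openin_continuous_map_preimage [OF continuous_map_flow_time [OF u that(1)] that(2)] by simp
    then show ?thesis
      using that(3) by (auto simp: open_dist dist_real_def)
  qed
  have Hcont: "continuous_map X euclideanreal H"
    using A Ck_on_imp_continuous_on [OF HCk] by (rule continuous_map_of_charts)
  have inv: "H (u (t, y)) = H y" if y: "y \<in> topspace X" for t y
  proof -
    have Hder: "((\<lambda>s. H (u (s, y))) has_derivative (\<lambda>_. 0)) (at t)" for t
    proof -
      obtain c where c: "c \<in> \<A>" "u (t, y) \<in> fst c"
        using covering flow_in_topspace [OF u y] by blast
      obtain d where d: "d > 0" "\<And>s. \<bar>s - t\<bar> < d \<Longrightarrow> u (s, y) \<in> fst c"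
        using nearby [OF y op [OF c(1)] c(2)] by blast
      have sub: "(\<lambda>s. snd c (u (s, y))) ` ball t d \<subseteq> snd c ` fst c"
        using d(2) by (auto simp: dist_real_def abs_minus_commute)
      have 1: "((\<lambda>s. snd c (u (s, y))) has_derivative (\<lambda>h. h *\<^sub>R Y c (snd c (u (t, y))))) (at t within ball t d)"
        using vd [OF c(1) y c(2)] by (simp add: has_vector_derivative_def has_derivative_at_withinI)
      have 2: "(in_chart H c has_derivative (\<lambda>e. \<rho> c (snd c (u (t, y))) * area (Y c (snd c (u (t, y)))) e))
         (at (snd c (u (t, y))) within (\<lambda>s. snd c (u (s, y))) ` ball t d)"
        by (rule has_derivative_subset [OF der [OF c(1)] sub]) (use c in blast)
      have 3: "((\<lambda>s. in_chart H c (snd c (u (s, y)))) has_derivative (\<lambda>_. 0)) (at t within ball t d)"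
        using diff_chain_within [OF 1 2] by (simp add: o_def area_def mult.commute)
      have 4: "H (u (s, y)) = in_chart H c (snd c (u (s, y)))" if "s \<in> ball t d" for s
        using that by (intro Hc c d) (simp add: dist_real_def abs_minus_commute)
      have "((\<lambda>s. H (u (s, y))) has_derivative (\<lambda>_. 0)) (at t within ball t d)"
        by (rule has_derivative_transform [OF _ 4 3]) (use d(1) in auto)
      moreover have "at t within ball t d = at t"
        by (rule at_within_open) (use d(1) in auto)
      ultimately show ?thesis
        by (simp only:)
    qed
    have "H (u (t, y)) = H (u (0, y))"
      by (rule has_derivative_zero_unique [of UNIV]) (use Hder in auto)
    then show ?thesis
      by (simp add: flow_zero [OF u y])
  qed
  have box_u: "level_box X u H x" if x: "x \<in> topspace X" "x \<notin> Sing X u" for x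
  proof -
    have "\<exists>t. \<exists>c\<in>\<A>. u (t, x) \<in> fst c \<and> Y c (snd c (u (t, x))) \<noteq> 0"
    proof (rule ccontr)
      assume "\<nexists>t. \<exists>c\<in>\<A>. u (t, x) \<in> fst c \<and> Y c (snd c (u (t, x))) \<noteq> 0"
      then have Y0: "Y c (snd c (u (t, x))) = 0" if "c \<in> \<A>" "u (t, x) \<in> fst c" for c t
        using that by blast
      have "\<exists>d>0. \<forall>s. \<bar>s - t\<bar> < d \<longrightarrow> u (s, x) = u (t, x)" for t
      proof -
        obtain c where c: "c \<in> \<A>" "u (t, x) \<in> fst c"
          using covering flow_in_topspace [OF u x(1)] by blast
        obtain d where d: "d > 0" "\<And>s. \<bar>s - t\<bar> < d \<Longrightarrow> u (s, x) \<in> fst c"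
          using nearby [OF x(1) op [OF c(1)] c(2)] by blast
        have "((\<lambda>s. snd c (u (s, x))) has_derivative (\<lambda>_. 0)) (at s within ball t d)" if "s \<in> ball t d" for s
        proof -
          have "u (s, x) \<in> fst c"
            using d that by (auto simp: dist_real_def abs_minus_commute)
          then show ?thesis
            using vd [OF c(1) x(1)] Y0 [OF c(1)]
            by (force simp: has_vector_derivative_def intro: has_derivative_at_withinI)
        qed
        then have "snd c (u (s, x)) = snd c (u (t, x))" if "\<bar>s - t\<bar> < d" for s
          using has_derivative_zero_unique [of "ball t d" "\<lambda>s. snd c (u (s, x))" t s] d(1) that
          by (simp add: dist_real_def abs_minus_commute)
        then have "u (s, x) = u (t, x)" if "\<bar>s - t\<bar> < d" for s
          using inj [OF c(1)] d(2) c(2) that by (meson inj_onD)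
        then show ?thesis
          using d(1) by blast
      qed
      then show False
        using constant_of_locally_constant_flow [OF u X x(1)] x(2) by blast
    qed
    then obtain t c where c: "c \<in> \<A>" "u (t, x) \<in> fst c" "Y c (snd c (u (t, x))) \<noteq> 0"
      by blast
    have "level_box X u H (u (t, x))"
    proof (rule level_box_regular [where U = "fst c" and \<phi> = "snd c", where \<rho> = "\<rho> c" and Y = "Y c" and g = "in_chart H c"])
      show "continuous_on (snd c ` fst c) (Y c)"
        using hvf c(1) Ck_on_imp_continuous_on
        unfolding hamiltonian_vector_field_def vector_field_def by blast
      show "\<And>q. q \<in> snd c ` fst c \<Longrightarrow> \<rho> c q \<noteq> 0"
        using vol c(1) unfolding volume_form_def by blast
    qed (use u ch c der Hc inv vd in auto)
    \<comment> \<open>The box found at a regular point of the orbit is carried back to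
      \<open>x\<close> by the time \<open>- t\<close> map.\<close>
    then have "level_box X u H (u (- t, u (t, x)))"
    proof (rule level_box_transport [OF homeomorphic_map_flow [OF u], where u = u, rotated 2])
      show "\<exists>\<tau>. mono \<tau> \<and> (\<forall>s. u (- t, u (s, y)) = u (\<tau> s, u (- t, y)))" if "y \<in> topspace X" for y
        using that u by (intro exI [of _ "\<lambda>s. s"]) (auto simp: flow_add mono_def add.commute)
    qed (use inv flow_in_topspace [OF u x(1)] in auto)
    then show ?thesis
      by (simp add: flow_inverse [OF u x(1)])
  qed
  obtain h where h: "homeomorphic_map X X h"
    and "\<forall>x\<in>topspace X. h ` orbit u x = orbit v (h x) \<and>
      (\<exists>\<tau>::real \<Rightarrow> real. continuous_on UNIV \<tau> \<and> strict_mono \<tau> \<and> surj \<tau> \<and>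
        (\<forall>t. h (u (t, x)) = v (\<tau> t, h x)))"
    using equ unfolding topologically_equivalent_def by (elim exE conjE)
  then have par: "\<exists>\<tau>::real \<Rightarrow> real. strict_mono \<tau> \<and> surj \<tau> \<and> (\<forall>t. h (u (t, x)) = v (\<tau> t, h x))"
    if "x \<in> topspace X" for x
    using that by blast
  obtain k where hk: "homeomorphic_maps X X h k"
    using h homeomorphic_map_maps by blast
  have kh: "k (h x) = x" "h (k x) = x" "k x \<in> topspace X" if "x \<in> topspace X" for x
    using hk that homeomorphic_maps_def [of X X h k] by (auto simp: continuous_map_def)
  define G where "G = (\<lambda>x. H (k x))"
  show ?thesis
  proof
    show "continuous_map X euclideanreal G"
      using continuous_map_compose [OF _ Hcont, of X k] hk unfolding G_def
      by (simp add: homeomorphic_maps_def o_def)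
    show "G (v (t, x)) = G x" if x: "x \<in> topspace X" for t x
    proof -
      \<comment> \<open>Surjectivity of \<open>\<tau>\<close> makes every \<open>v\<close>-time the
        image of a \<open>u\<close>-time, so that \<open>G\<close> is constant on whole orbits of
        \<open>v\<close>.\<close>
      obtain \<tau> where \<tau>: "surj \<tau>" "\<And>t. h (u (t, k x)) = v (\<tau> t, x)"
        using par [OF kh(3) [OF x]] kh(2) [OF x] by auto
      obtain s where "t = \<tau> s"
        using \<tau>(1) by blast
      then have "v (t, x) = h (u (s, k x))"
        using \<tau> by simp
      then show ?thesis
        using kh x inv by (simp add: G_def flow_in_topspace [OF u])
    qed
    show "level_box X v G x" if x: "x \<in> topspace X" "x \<notin> Sing X v" for x
    proof -
      have "k x \<notin> Sing X u"
      proof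
        assume "k x \<in> Sing X u"
        obtain \<tau> where \<tau>: "surj \<tau>" "\<And>t. h (u (t, k x)) = v (\<tau> t, x)"
          using par [OF kh(3) [OF x(1)]] kh(2) [OF x(1)] by auto
        have "v (\<tau> t, x) = x" for t
          using \<tau>(2) [of t] Sing_fixed [OF \<open>k x \<in> Sing X u\<close>] kh(2) [OF x(1)] by simp
        then have "v (t, x) = x" for t
          using \<tau>(1) by (metis surjD)
        then show False
          using x by (simp add: Sing_def)
      qed
      then have "level_box X u H (k x)"
        using box_u kh x by blast
      then have "level_box X v G (h (k x))"
      proof (rule level_box_transport [OF h, where u = u, rotated 2])
        show "\<exists>\<tau>::real \<Rightarrow> real. mono \<tau> \<and> (\<forall>t. h (u (t, y)) = v (\<tau> t, h y))" if "y \<in> topspace X" for y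
          using par [OF that] strict_mono_mono by blast
      qed (use kh x in \<open>auto simp: G_def\<close>)
      then show ?thesis
        by (simp add: kh(2) [OF x(1)])
    qed
  qed
qed


section \<open>Periods\<close>

lemma flow_int_multiple_period:
  assumes v: "flow X v" and x: "x \<in> topspace X" and a: "v (a, x) = x"
  shows "v (of_int k * a, x) = x"
proof -
  have nat: "v (of_nat n * a, x) = x" for n
  proof (induction n)
    case 0
    then show ?case using flow_zero [OF v x] by simp
  next
    case (Suc n)
    have "v (of_nat (Suc n) * a, x) = v (of_nat n * a, v (a, x))"
      using flow_add [OF v x] by (simp add: algebra_simps)
    then show ?case using Suc a by simp
  qed
  show ?thesis
  proof (cases "k \<ge> 0")
    case True
    then show ?thesis using nat [of "nat k"] by simp
  next
    case False
    then have "of_nat (nat (- k)) * a = - (of_int k * a)"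
      by simp
    then have "v (- (of_int k * a), x) = x"
      using nat [of "nat (- k)"] by metis
    then show ?thesis
      using flow_inverse [OF v x, of "- (of_int k * a)"] by simp
  qed
qed

text \<open>If \<open>a / b\<close> were irrational, the integer combinations of \<open>a\<close>
  and \<open>b\<close> would be a dense set of periods; periods form a closed set, so
  \<open>x\<close> would be singular.\<close>

lemma periods_commensurable:
  assumes v: "flow X v" and X: "Hausdorff_space X" and x: "x \<in> topspace X" "x \<notin> Sing X v"
    and a: "v (a, x) = x" and b: "v (b, x) = x" "b > 0"
  shows "a / b \<in> \<rat>"
proof (rule ccontr)
  assume irr: "a / b \<notin> \<rat>"
  have "t \<in> closure {t. v (t, x) = x}" for t
    unfolding closure_approachable
  proof (intro allI impI)
    fix e :: real assume "e > 0"
    then obtain h k :: int where "k > 0" "\<bar>of_int k * (a / b) - of_int h - t / b\<bar> < e / b"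
      by (rule_tac sequence_of_fractional_parts_is_dense [OF irr, of "e / b" "t / b"]) (use b in auto)
    moreover have "of_int k * (a / b) - of_int h - t / b = (of_int k * a - of_int h * b - t) / b"
      using b by (simp add: field_simps)
    ultimately have "\<bar>of_int k * a - of_int h * b - t\<bar> < e"
      using b by (simp add: abs_divide divide_less_cancel)
    moreover have "v (of_int k * a - of_int h * b, x) = x"
      using flow_add [OF v x(1), of "of_int k * a" "of_int (- h) * b"]
        flow_int_multiple_period [OF v x(1) a, of k] flow_int_multiple_period [OF v x(1) b(1), of "- h"]
      by simp
    ultimately show "\<exists>y\<in>{t. v (t, x) = x}. dist y t < e"
      by (auto simp: dist_real_def)
  qed
  then have "v (t, x) = x" for t
    using closed_periods [OF v X x(1)] by (simp add: closure_closed)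
  then show False
    using x by (simp add: Sing_def)
qed

lemma connectedin_finite_Hausdorff:
  assumes X: "Hausdorff_space X" and K: "connectedin X K" "finite K" "x \<in> K"
  shows "K = {x}"
proof (rule ccontr)
  assume "K \<noteq> {x}"
  then obtain y where y: "y \<in> K" "y \<noteq> x"
    using K by blast
  have KX: "K \<subseteq> topspace X"
    using K connectedin_subset_topspace by blast
  have "openin X (topspace X - (K - {x}))" "openin X (topspace X - {x})"
    using X K KX by (auto intro!: openin_diff closedin_Hausdorff_finite)
  moreover have "K \<subseteq> (topspace X - (K - {x})) \<union> (topspace X - {x})"
    "(topspace X - (K - {x})) \<inter> (topspace X - {x}) \<inter> K = {}"
    "(topspace X - (K - {x})) \<inter> K \<noteq> {}" "(topspace X - {x}) \<inter> K \<noteq> {}"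
    using K KX y by auto
  ultimately show False
    using K(1) unfolding connectedin by blast
qed


section \<open>Flows preserving a function with simple levels\<close>

text \<open>What survives of the Hamiltonian structure: no chart, form or field occurs in it. The
  assumptions persist under rescaling time by \<open>exp (l * H x)\<close>, so the results apply to
  \<open>w\<close> as well as to \<open>v\<close>.\<close>

locale level_flow =
  fixes X :: "'a topology" and v :: "real \<times> 'a \<Rightarrow> 'a" and H :: "'a \<Rightarrow> real"
  assumes flow: "flow X v" and compact: "compact_space X" and Hausdorff: "Hausdorff_space X"
    and cont: "continuous_map X euclideanreal H"
    and invariant: "\<And>x t. x \<in> topspace X \<Longrightarrow> H (v (t, x)) = H x"
    and finite_Sing: "finite (Sing X v)"
    and box: "\<And>x. x \<in> topspace X \<Longrightarrow> x \<notin> Sing X v \<Longrightarrow> level_box X v H x"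
begin

lemma openin_H_preimage: "open J \<Longrightarrow> openin X {x \<in> topspace X. H x \<in> J}"
  using openin_continuous_map_preimage [OF cont] by simp

lemma closedin_H_preimage: "closed J \<Longrightarrow> closedin X {x \<in> topspace X. H x \<in> J}"
  using closedin_continuous_map_preimage [OF cont] by simp

lemma closedin_Sing: "closedin X (Sing X v)"
  using finite_Sing Hausdorff by (intro closedin_Hausdorff_finite) (auto simp: Sing_def)

text \<open>\<open>W\<close> is the saturation of a level box by the flow. As \<open>H\<close> is
  invariant, two points of \<open>W\<close> on one level can be pushed into the box and compared
  there.\<close>

lemma saturated_box:
  assumes x: "x \<in> topspace X" "x \<notin> Sing X v"
  obtains W where "openin X W" "orbit v x \<subseteq> W"
    "\<And>y z. y \<in> W \<Longrightarrow> z \<in> W \<Longrightarrow> H y = H z \<Longrightarrow> z \<in> orbit v y"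
proof -
  obtain U where U: "openin X U" "x \<in> U"
    and orb: "\<And>y z. y \<in> U \<Longrightarrow> z \<in> U \<Longrightarrow> H y = H z \<Longrightarrow> z \<in> orbit v y"
    using box [OF x] unfolding level_box_def by metis
  define W where "W = (\<Union>t. {y \<in> topspace X. v (t, y) \<in> U})"
  show ?thesis
  proof
    show "openin X W"
      unfolding W_def
      using openin_continuous_map_preimage [OF continuous_map_flow_space [OF flow] U(1)] by blast
    show "orbit v x \<subseteq> W"
    proof
      fix y assume "y \<in> orbit v x"
      then obtain t where "y = v (t, x)"
        by (auto simp: in_orbit_iff)
      then have "y \<in> topspace X" "v (- t, y) = x"
        using flow_inverse [OF flow x(1)] flow_in_topspace [OF flow x(1)] by auto
      then show "y \<in> W"
        using U(2) by (auto simp: W_def)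
    qed
    show "z \<in> orbit v y" if yz: "y \<in> W" "z \<in> W" "H y = H z" for y z
    proof -
      obtain s t where s: "y \<in> topspace X" "v (s, y) \<in> U" and t: "z \<in> topspace X" "v (t, z) \<in> U"
        using yz by (auto simp: W_def)
      then have "v (t, z) \<in> orbit v (v (s, y))"
        using orb invariant yz(3) by metis
      then have "orbit v (v (t, z)) = orbit v (v (s, y))"
        using orbit_eq [OF flow] flow_in_topspace [OF flow] s by blast
      moreover have "orbit v (v (t, z)) = orbit v z" "orbit v (v (s, y)) = orbit v y"
        using orbit_eq [OF flow] s t by (auto simp: in_orbit_iff)
      ultimately show ?thesis
        using self_in_orbit [OF flow t(1)] by simp
    qed
  qed
qed

text \<open>Saturated boxes make each orbit relatively open among the nonsingular points of its
  level, so several orbits would disconnect \<open>K\<close>. The orbit may be noncompact, which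
  suits the aperiodic case.\<close>

lemma connected_regular_level_subset_orbit:
  assumes K: "connectedin X K" "x \<in> K"
    and sub: "\<And>y. y \<in> K \<Longrightarrow> y \<notin> Sing X v \<and> H y = H x"
  shows "K \<subseteq> orbit v x"
proof (rule ccontr)
  assume not: "\<not> K \<subseteq> orbit v x"
  have KX: "K \<subseteq> topspace X"
    using K connectedin_subset_topspace by blast
  define P where "P = (\<lambda>y W. openin X W \<and> orbit v y \<subseteq> W \<and>
     (\<forall>a\<in>W. \<forall>b\<in>W. H a = H b \<longrightarrow> b \<in> orbit v a))"
  have "\<exists>W. P y W" if "y \<in> K" for y
  proof -
    have "y \<in> topspace X" "y \<notin> Sing X v"
      using KX sub that by auto
    from saturated_box [OF this] obtain W where "openin X W" "orbit v y \<subseteq> W"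
        "\<And>a b. a \<in> W \<Longrightarrow> b \<in> W \<Longrightarrow> H a = H b \<Longrightarrow> b \<in> orbit v a"
      by blast
    then show ?thesis
      unfolding P_def by (intro exI [of _ W]) simp
  qed
  then obtain W where W: "\<And>y. y \<in> K \<Longrightarrow> P y (W y)"
    by metis
  have self: "y \<in> W y" if "y \<in> K" for y
    using W [OF that] self_in_orbit [OF flow] KX that unfolding P_def by blast
  define E where "E = (\<Union>y\<in>K - orbit v x. W y)"
  have "openin X (W x)" "openin X E"
    using W K(2) unfolding E_def P_def by auto
  moreover have "K \<subseteq> W x \<union> E"
    using self W [OF K(2)] by (auto simp: E_def P_def)
  moreover have "W x \<inter> E \<inter> K = {}"
  proof (rule ccontr)
    assume "W x \<inter> E \<inter> K \<noteq> {}"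
    then obtain a y where a: "a \<in> K" "a \<in> W x" and y: "y \<in> K" "y \<notin> orbit v x" "a \<in> W y"
      by (auto simp: E_def)
    have "x \<in> orbit v a" "y \<in> orbit v a"
      using W [OF K(2)] W [OF y(1)] a y self [OF K(2)] self [OF y(1)] sub unfolding P_def by metis+
    then have "orbit v x = orbit v y"
      using orbit_eq [OF flow] a KX by (metis subsetD)
    then show False
      using y KX self_in_orbit [OF flow] by blast
  qed
  moreover have "W x \<inter> K \<noteq> {}" "E \<inter> K \<noteq> {}"
    using self K(2) not by (auto simp: E_def)
  ultimately show False
    using K(1) unfolding connectedin by blast
qed

text \<open>A connected set of compact orbits that leaves the orbit of \<open>x\<close> meets all levels on one side of
  \<open>H x\<close>; as levels near \<open>x\<close> are single orbits, it then contains an open set.\<close>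

lemma connected_compact_orbits_subset_orbit:
  assumes C: "\<And>y z. y \<in> C \<Longrightarrow> z \<in> orbit v y \<Longrightarrow> z \<in> C"
    and thin: "\<And>W. openin X W \<Longrightarrow> W \<noteq> {} \<Longrightarrow> W \<inter> Sing X v = {} \<Longrightarrow> \<not> W \<subseteq> C"
    and K: "connectedin X K" "K \<subseteq> C" and x: "x \<in> K" "x \<notin> Sing X v"
    and cpt: "compactin X (orbit v x)"
  shows "K \<subseteq> orbit v x"
proof (rule ccontr)
  assume "\<not> K \<subseteq> orbit v x"
  then obtain z0 where z0: "z0 \<in> K" "z0 \<notin> orbit v x"
    by blast
  have KX: "K \<subseteq> topspace X"
    using K connectedin_subset_topspace by blast
  then have xX: "x \<in> topspace X"
    using x by blast
  obtain W where W: "openin X W" "orbit v x \<subseteq> W"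
    and orb: "\<And>y z. y \<in> W \<Longrightarrow> z \<in> W \<Longrightarrow> H y = H z \<Longrightarrow> z \<in> orbit v y"
    using saturated_box [OF xX x(2)] by blast
  have "normal_space X"
    using compact Hausdorff by (intro compact_Hausdorff_or_regular_imp_normal_space) auto
  moreover have "closedin X (orbit v x)"
    using cpt Hausdorff compactin_imp_closedin by blast
  \<comment> \<open>The orbit is closed, so normality fits a closed neighbourhood between it and
    \<open>W\<close>. The frontier of \<open>V\<close> then misses the level of \<open>x\<close>,
    since that level meets \<open>W\<close> only in the orbit, which lies in
    \<open>V\<close>.\<close>
  ultimately obtain V where V: "openin X V" "orbit v x \<subseteq> V" "X closure_of V \<subseteq> W"
    using W(1,2) unfolding normal_space_alt by metis
  have VX: "V \<subseteq> topspace X"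
    using V(1) by (rule openin_subset)
  then have Vcl: "V \<subseteq> X closure_of V"
    by (rule closure_of_subset)
  have xV: "x \<in> V"
    using V self_in_orbit [OF flow xX] by blast
  define B where "B = X closure_of V - V"
  have "closedin X B"
    unfolding B_def using V(1) by (simp add: closedin_diff)
  then have "compact (H ` B)"
    using compact cont image_compactin closedin_compact_space compactin_euclidean_iff by metis
  moreover have "H x \<notin> H ` B"
  proof
    assume "H x \<in> H ` B"
    then obtain b where b: "b \<in> B" "H x = H b"
      by blast
    then have "b \<in> orbit v x"
      using orb [of x b] xV Vcl V(3) by (auto simp: B_def)
    then show False
      using b V by (auto simp: B_def)
  qed
  ultimately obtain \<delta>0 where \<delta>0: "\<delta>0 > 0" "\<And>b. b \<in> B \<Longrightarrow> \<delta>0 \<le> \<bar>H x - H b\<bar>"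
    using separate_point_closed [OF compact_imp_closed, of "H ` B" "H x"] by (auto simp: dist_real_def)
  \<comment> \<open>The second bound keeps \<open>z0\<close> out of the band \<open>E1\<close> below
    when \<open>z0\<close> lies on another level. On the level of \<open>x\<close> it is outside
    \<open>V\<close> already, because it is not on the orbit.\<close>
  define \<delta> where "\<delta> = (if H z0 = H x then \<delta>0 else min \<delta>0 \<bar>H x - H z0\<bar>)"
  have \<delta>: "\<delta> > 0" "\<delta> \<le> \<delta>0"
    using \<delta>0 by (auto simp: \<delta>_def)
  have "\<exists>a b. a < b \<and> {a<..<b} \<subseteq> H ` (K \<inter> V)"
  proof (rule ccontr)
    assume no: "\<nexists>a b. a < b \<and> {a<..<b} \<subseteq> H ` (K \<inter> V)"
    \<comment> \<open>If no interval of levels were covered, a level would be missing on each side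
      of \<open>H x\<close>; the part of \<open>V\<close> between the missing levels
      \<open>h1\<close> and \<open>h2\<close> would be open and closed in \<open>K\<close>, contain
      \<open>x\<close> and omit \<open>z0\<close>.\<close>
    have "\<not> {H x - \<delta><..<H x} \<subseteq> H ` (K \<inter> V)" "\<not> {H x<..<H x + \<delta>} \<subseteq> H ` (K \<inter> V)"
      using no \<delta>(1) by (metis diff_less_eq less_add_same_cancel1)+
    then obtain h1 h2 where h1: "H x - \<delta> < h1" "h1 < H x" "h1 \<notin> H ` (K \<inter> V)"
      and h2: "H x < h2" "h2 < H x + \<delta>" "h2 \<notin> H ` (K \<inter> V)"
      by (auto simp: subset_iff)
    define E1 where "E1 = V \<inter> {z \<in> topspace X. H z \<in> {h1<..<h2}}"
    define E2 where "E2 = topspace X - (X closure_of V \<inter> {z \<in> topspace X. H z \<in> {h1..h2}})"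
    have "openin X E1"
      unfolding E1_def by (intro openin_Int V(1) openin_H_preimage) auto
    moreover have "openin X E2"
      unfolding E2_def using closedin_H_preimage [of "{h1..h2}"] by (intro openin_diff closedin_Int) auto
    moreover have cover: "z \<in> E1 \<union> E2" if "z \<in> K" for z
    proof (cases "z \<in> E2")
      case False
      then have z: "z \<in> X closure_of V" "h1 \<le> H z" "H z \<le> h2"
        using that KX by (auto simp: E2_def)
      then have "\<bar>H x - H z\<bar> < \<delta>0"
        using h1 h2 \<delta> by linarith
      then have "z \<in> V"
        using \<delta>0(2) [of z] z(1) by (force simp: B_def)
      then have "H z \<noteq> h1" "H z \<noteq> h2"
        using that h1 h2 by auto
      then show ?thesis
        using z \<open>z \<in> V\<close> VX by (auto simp: E1_def)
    qed auto
    moreover have "E1 \<inter> E2 \<inter> K = {}"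
      using Vcl by (auto simp: E1_def E2_def)
    moreover have "x \<in> E1"
      using h1 h2 xV xX by (auto simp: E1_def)
    moreover have "z0 \<notin> E1"
    proof
      assume "z0 \<in> E1"
      then have z: "z0 \<in> V" "\<bar>H x - H z0\<bar> < \<delta>"
        using h1 h2 by (auto simp: E1_def)
      then have "H z0 = H x"
        by (auto simp: \<delta>_def split: if_splits)
      then show False
        using orb [of x z0] z xV Vcl V(3) z0(2) by auto
    qed
    ultimately show False
      using K(1) x(1) z0(1) unfolding connectedin
      by (metis (no_types, lifting) IntI UnE disjoint_iff subsetI)
  qed
  then obtain a b where ab: "a < b" "{a<..<b} \<subseteq> H ` (K \<inter> V)"
    by blast
  \<comment> \<open>Inside \<open>W\<close>, every point of \<open>Q\<close> shares its level with a
    point of \<open>K\<close>, hence also its orbit, so \<open>Q\<close> lies in the saturated set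
    \<open>C\<close>. It meets infinitely many levels, so removing the singular points does not
    empty it.\<close>
  define Q where "Q = V \<inter> {z \<in> topspace X. H z \<in> {a<..<b}}"
  have "openin X (Q - Sing X v)"
    unfolding Q_def using V(1) openin_H_preimage [of "{a<..<b}"] closedin_Sing
    by (intro openin_diff openin_Int) auto
  moreover have "Q - Sing X v \<noteq> {}"
  proof
    assume "Q - Sing X v = {}"
    then have "finite Q"
      using finite_subset [OF _ finite_Sing, of Q] by simp
    moreover have "{a<..<b} \<subseteq> H ` Q"
      using ab(2) VX by (fastforce simp: Q_def)
    ultimately show False
      using ab(1) by (meson finite_imageI finite_subset infinite_Ioo)
  qed
  moreover have "Q - Sing X v \<subseteq> C"
  proof
    fix z assume z: "z \<in> Q - Sing X v"
    then obtain y where y: "y \<in> K" "y \<in> V" "H z = H y"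
      using ab(2) by (auto simp: Q_def)
    then have "z \<in> orbit v y"
      using orb [of y z] z Vcl V(3) by (auto simp: Q_def)
    then show "z \<in> C"
      using C y K by blast
  qed
  ultimately show False
    using thin by blast
qed

text \<open>Adds the case of a singular \<open>x\<close>: a nonsingular point of \<open>K\<close>
  would trap \<open>K\<close> in its own orbit, which has no singular point; so \<open>K\<close>
  lies in the finite set \<open>Sing X v\<close> and is a single point.\<close>

lemma connected_closed_orbits_subset_orbit:
  assumes C: "\<And>y z. y \<in> C \<Longrightarrow> z \<in> orbit v y \<Longrightarrow> z \<in> C"
    and thin: "\<And>W. openin X W \<Longrightarrow> W \<noteq> {} \<Longrightarrow> W \<inter> Sing X v = {} \<Longrightarrow> \<not> W \<subseteq> C"
    and cpt: "\<And>y. y \<in> C \<Longrightarrow> compactin X (orbit v y)"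
    and K: "connectedin X K" "K \<subseteq> C" and x: "x \<in> K"
  shows "K \<subseteq> orbit v x"
proof (cases "x \<in> Sing X v")
  case False
  show ?thesis
    by (rule connected_compact_orbits_subset_orbit [OF C thin K x False cpt]) (use K x in auto)
next
  case True
  have xX: "x \<in> topspace X"
    using K x connectedin_subset_topspace by blast
  have "K \<subseteq> Sing X v"
  proof (rule ccontr)
    assume "\<not> K \<subseteq> Sing X v"
    then obtain y where y: "y \<in> K" "y \<notin> Sing X v"
      by blast
    have yX: "y \<in> topspace X"
      using K y connectedin_subset_topspace by blast
    have "K \<subseteq> orbit v y"
      by (rule connected_compact_orbits_subset_orbit [OF C thin K y cpt]) (use K y in auto)
    then have "x \<in> orbit v y"
      using x by blast
    then show False
      using True flow_notin_Sing [OF flow yX y(2)] by (auto simp: in_orbit_iff)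
  qed
  then have "finite K"
    using finite_Sing by (rule finite_subset)
  then have "K = {x}"
    using connectedin_finite_Hausdorff [OF Hausdorff K(1) _ x] by blast
  then show ?thesis
    using self_in_orbit [OF flow xX] by simp
qed

text \<open>At a nonsingular \<open>z\<close> there would be a level box, in which points on the
  level of \<open>x\<close> are within bounded time of \<open>z\<close>. Two visits at distant times
  then hit \<open>z\<close> itself at two different times, giving \<open>x\<close> a nonzero period.
  The condition on \<open>\<bar>t\<bar>\<close> covers both time directions.\<close>

lemma limit_point_in_Sing:
  assumes x: "x \<in> topspace X" "\<And>t. v (t, x) = x \<Longrightarrow> t = 0"
    and z: "z \<in> topspace X" "\<And>U n. openin X U \<Longrightarrow> z \<in> U \<Longrightarrow> \<exists>t. \<bar>t\<bar> > n \<and> v (t, x) \<in> U"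
  shows "z \<in> Sing X v" "H z = H x"
proof -
  show Hz: "H z = H x"
  proof (rule ccontr)
    assume "H z \<noteq> H x"
    moreover have "openin X {y \<in> topspace X. H y \<in> - {H x}}"
      by (intro openin_H_preimage) auto
    ultimately show False
      using z(2) [of "{y \<in> topspace X. H y \<in> - {H x}}" 0] z(1) invariant [OF x(1)] by auto
  qed
  show "z \<in> Sing X v"
  proof (rule ccontr)
    assume "z \<notin> Sing X v"
    then obtain U M where U: "openin X U" "z \<in> U"
      and M: "\<And>y. y \<in> U \<Longrightarrow> H y = H z \<Longrightarrow> \<exists>s. \<bar>s\<bar> \<le> M \<and> y = v (s, z)"
      using box [OF z(1)] unfolding level_box_def by metis
    have hit: "\<exists>s. \<bar>s\<bar> \<le> M \<and> v (t - s, x) = z" if t: "v (t, x) \<in> U" for t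
    proof -
      obtain s where "\<bar>s\<bar> \<le> M" "v (t, x) = v (s, z)"
        using M t Hz invariant [OF x(1)] by metis
      then show ?thesis
        using flow_inverse [OF flow z(1), of s] flow_add [OF flow x(1), of "- s" t] by auto
    qed
    obtain t1 where "v (t1, x) \<in> U"
      using z(2) [OF U, of 0] by blast
    then obtain s1 where s1: "v (t1 - s1, x) = z"
      using hit by blast
    \<comment> \<open>Large enough that \<open>t2 - s2\<close> differs from \<open>t1 - s1\<close>
      even if \<open>s2\<close> uses up the whole bound \<open>M\<close>.\<close>
    obtain t2 where t2: "\<bar>t2\<bar> > M + \<bar>t1 - s1\<bar>" "v (t2, x) \<in> U"
      using z(2) [OF U] by blast
    then obtain s2 where s2: "\<bar>s2\<bar> \<le> M" "v (t2 - s2, x) = z"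
      using hit by blast
    have "v (- (t1 - s1) + (t2 - s2), x) = x"
      using flow_add [OF flow x(1), of "- (t1 - s1)" "t2 - s2"] s1 s2 flow_inverse [OF flow x(1), of "t1 - s1"]
      by simp
    then have "- (t1 - s1) + (t2 - s2) = 0"
      using x(2) by blast
    then show False
      using t2(1) s2(1) by linarith
  qed
qed

text \<open>Two exponents that fail on the same basic open set force \<open>exp ((l - l') * H y)\<close> to be rational
  there, although \<open>H\<close> takes uncountably many values.\<close>

lemma countable_resonant_exponents:
  assumes "second_countable X"
  shows "countable {l. \<exists>W. openin X W \<and> W \<noteq> {} \<and> W \<inter> Sing X v = {} \<and>
    (\<forall>y\<in>W. \<exists>n>0. v (exp (l * H y) * real n, y) = y)}" (is "countable ?L")
proof -
  define R where "R = (\<lambda>W l. W \<inter> Sing X v = {} \<and> (\<forall>y\<in>W. \<exists>n>0. v (exp (l * H y) * real n, y) = y))"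
  obtain \<B> where \<B>: "countable \<B>" "\<And>V. V \<in> \<B> \<Longrightarrow> openin X V"
    and basis: "\<And>U x. openin X U \<Longrightarrow> x \<in> U \<Longrightarrow> \<exists>V\<in>\<B>. x \<in> V \<and> V \<subseteq> U"
    using assms unfolding second_countable_def by metis
  have unique: "l = l'" if V: "V \<in> \<B>" "V \<noteq> {}" "R V l" "R V l'" for V l l'
  proof (rule ccontr)
    assume ne: "l \<noteq> l'"
    have "exp ((l - l') * H y) \<in> \<rat>" if y: "y \<in> V" for y
    proof -
      have yX: "y \<in> topspace X" "y \<notin> Sing X v"
        using y V \<B>(2) openin_subset unfolding R_def by blast+
      obtain n m where n: "n > 0" "v (exp (l * H y) * real n, y) = y"
        and m: "m > 0" "v (exp (l' * H y) * real m, y) = y"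
        using V y unfolding R_def by metis
      have "(exp (l * H y) * real n) / (exp (l' * H y) * real m) \<in> \<rat>"
        using n m by (intro periods_commensurable [OF flow Hausdorff yX]) auto
      moreover have "real m / real n \<in> \<rat>"
        by (intro Rats_divide Rats_of_nat)
      ultimately have "(exp (l * H y) * real n) / (exp (l' * H y) * real m) * (real m / real n) \<in> \<rat>"
        by (rule Rats_mult)
      moreover have "(exp (l * H y) * real n) / (exp (l' * H y) * real m) * (real m / real n) =
          exp ((l - l') * H y)"
        using n m by (simp add: field_simps exp_diff left_diff_distrib)
      ultimately show ?thesis
        by simp
    qed
    then have "(\<lambda>h. exp ((l - l') * h)) ` H ` V \<subseteq> \<rat>"
      by auto
    then have "countable ((\<lambda>h. exp ((l - l') * h)) ` H ` V)"
      using countable_rat countable_subset by blast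
    moreover have "inj_on (\<lambda>h. exp ((l - l') * h)) (H ` V)"
      using ne by (auto simp: inj_on_def)
    ultimately have "countable (H ` V)"
      using countable_image_inj_on by blast
    moreover obtain x where x: "x \<in> V"
      using V by blast
    then have "level_box X v H x"
      using V(3) openin_subset [OF \<B>(2) [OF V(1)]] by (intro box) (auto simp: R_def)
    then have "uncountable (H ` V)"
      using \<B>(2) [OF V(1)] x by (simp add: level_box_def)
    ultimately show False
      by simp
  qed
  have sub: "?L \<subseteq> (\<Union>V\<in>{V \<in> \<B>. V \<noteq> {}}. {l. R V l})"
  proof
    fix l assume "l \<in> ?L"
    then obtain W where W: "openin X W" "W \<noteq> {}" "R W l"
      unfolding R_def by blast
    then obtain x V where "V \<in> \<B>" "x \<in> V" "V \<subseteq> W"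
      using basis by blast
    then show "l \<in> (\<Union>V\<in>{V \<in> \<B>. V \<noteq> {}}. {l. R V l})"
    proof -
      have "R V l"
        using W(3) \<open>V \<subseteq> W\<close> unfolding R_def by blast
      then show ?thesis
        using \<open>V \<in> \<B>\<close> \<open>x \<in> V\<close> by auto
    qed
  qed
  have one: "countable {l. R V l}" if "V \<in> \<B>" "V \<noteq> {}" for V
  proof (cases "{l. R V l} = {}")
    case False
    then obtain l where "R V l"
      by blast
    then have "{l. R V l} = {l}"
      using unique that by blast
    then show ?thesis
      by simp
  qed simp
  have "countable {V \<in> \<B>. V \<noteq> {}}"
    using \<B>(1) by (rule countable_subset [rotated]) blast
  then have "countable (\<Union>V\<in>{V \<in> \<B>. V \<noteq> {}}. {l. R V l})"
    by (rule countable_UN) (simp add: one)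
  with sub show ?thesis
    by (rule countable_subset)
qed

end

section \<open>Rescaling time by a conserved quantity\<close>

lemma continuous_map_real_compose:
  assumes "continuous_map Z euclideanreal g" "continuous_on UNIV f"
  shows "continuous_map Z euclidean (\<lambda>z. f (g z))"
  using continuous_map_compose [OF assms(1), of euclidean f] assms(2) by (simp add: o_def)

text \<open>The exponential keeps the factor positive whatever the range of \<open>H\<close>, so
  that orbits and their direction are preserved.\<close>

definition rescale :: "('a \<Rightarrow> real) \<Rightarrow> (real \<times> 'a \<Rightarrow> 'a) \<Rightarrow> real \<times> 'a \<Rightarrow> 'a" where
  "rescale H v = (\<lambda>(t, x). v (exp (H x) * t, x))"

lemma rescale_apply: "rescale H v (t, x) = v (exp (H x) * t, x)"
  by (simp add: rescale_def)

lemma flow_rescale: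
  assumes v: "flow X v" and cont: "continuous_map X euclideanreal H"
    and inv: "\<And>x t. x \<in> topspace X \<Longrightarrow> H (v (t, x)) = H x"
  shows "flow X (rescale H v)"
  unfolding flow_def
proof (intro conjI ballI allI)
  have "continuous_map (prod_topology euclideanreal X) euclideanreal (\<lambda>z. H (snd z))"
    using continuous_map_compose [OF continuous_map_snd cont] by (simp add: o_def)
  then have "continuous_map (prod_topology euclideanreal X) euclideanreal (\<lambda>z. exp (H (snd z)))"
    by (rule continuous_map_real_compose) (intro continuous_intros)
  then have "continuous_map (prod_topology euclideanreal X) euclideanreal (\<lambda>z. exp (H (snd z)) * fst z)"
    by (rule continuous_map_real_mult) (rule continuous_map_fst)
  then show "continuous_map (prod_topology euclideanreal X) X (rescale H v)"
    unfolding rescale_def case_prod_unfold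
    by (intro continuous_map_flow_compose [OF v] continuous_map_snd)
  show "rescale H v (0, x) = x" if "x \<in> topspace X" for x
    using flow_zero [OF v that] by (simp add: rescale_apply)
  show "rescale H v (s + t, x) = rescale H v (s, rescale H v (t, x))" if "x \<in> topspace X" for x s t
    using flow_add [OF v that] inv [OF that] by (simp add: rescale_apply algebra_simps)
qed

lemma orbit_rescale: "orbit (rescale H v) x = orbit v x"
proof -
  have "v (t, x) = rescale H v (t / exp (H x), x)" for t
    by (simp add: rescale_apply)
  then show ?thesis
    unfolding orbit_def rescale_apply by (metis rescale_apply)
qed

lemma Sing_rescale: "Sing X (rescale H v) = Sing X v"
proof -
  have "(\<forall>t. rescale H v (t, x) = x) \<longleftrightarrow> orbit (rescale H v) x \<subseteq> {x}"
    and "(\<forall>t. v (t, x) = x) \<longleftrightarrow> orbit v x \<subseteq> {x}" for x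
    by (auto simp: orbit_def)
  then show ?thesis
    by (simp add: Sing_def orbit_rescale)
qed

lemma level_flow_rescale:
  assumes "level_flow X v H"
  shows "level_flow X (rescale (\<lambda>x. l * H x) v) H"
proof -
  interpret level_flow X v H by fact
  let ?w = "rescale (\<lambda>x. l * H x) v"
  show ?thesis
  proof
    show "flow X ?w"
      using cont invariant by (intro flow_rescale flow continuous_map_real_mult_left) auto
    show "H (?w (t, x)) = H x" if "x \<in> topspace X" for x t
      using invariant [OF that] by (simp add: rescale_apply)
    show "level_box X ?w H x" if "x \<in> topspace X" "x \<notin> Sing X ?w" for x
    proof -
      have "level_box X v H x"
        using box that by (simp add: Sing_rescale)
      then obtain U M where U: "openin X U" "x \<in> U" "\<And>y z. y \<in> U \<Longrightarrow> z \<in> U \<Longrightarrow> H y = H z \<Longrightarrow> z \<in> orbit v y"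
        and M: "\<And>z. z \<in> U \<Longrightarrow> H z = H x \<Longrightarrow> \<exists>s. \<bar>s\<bar> \<le> M \<and> z = v (s, x)"
        and unc: "\<And>W. openin X W \<Longrightarrow> x \<in> W \<Longrightarrow> uncountable (H ` W)"
        unfolding level_box_def by metis
      have "\<exists>s. \<bar>s\<bar> \<le> M / exp (l * H x) \<and> z = ?w (s, x)" if z: "z \<in> U" "H z = H x" for z
      proof -
        obtain s where "\<bar>s\<bar> \<le> M" "z = v (s, x)"
          using M z by blast
        then show ?thesis
          by (intro exI [of _ "s / exp (l * H x)"]) (simp add: rescale_apply divide_right_mono)
      qed
      then show ?thesis
        unfolding level_box_def orbit_rescale using U unc
        by (intro conjI exI [of _ U] exI [of _ "M / exp (l * H x)"]) simp_all
    qed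
  qed (use compact Hausdorff cont finite_Sing in \<open>auto simp: Sing_rescale\<close>)
qed


section \<open>Limit sets and weak orbits\<close>

text \<open>The \<open>\<omega>\<close>-limit set for \<open>s = 1\<close>, the \<open>\<alpha>\<close>-limit set for \<open>s = - 1\<close>.\<close>

definition time_limit :: "'a topology \<Rightarrow> (real \<times> 'a \<Rightarrow> 'a) \<Rightarrow> real \<Rightarrow> 'a \<Rightarrow> 'a set" where
  "time_limit X u s x = (\<Inter>n::real. X closure_of {u (t, x) | t. n < s * t})"

lemma omega_limit_eq: "omega_limit X u x = time_limit X u 1 x"
  by (simp add: omega_limit_def time_limit_def)

lemma alpha_limit_eq: "alpha_limit X u x = time_limit X u (- 1) x"
proof -
  have "time_limit X u (- 1) x = (\<Inter>n\<in>range uminus. X closure_of {u (t, x) | t. t < n})"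
    unfolding time_limit_def image_image by (simp add: less_minus_iff)
  then show ?thesis
    by (simp add: alpha_limit_def)
qed

lemma in_time_limit_iff:
  "p \<in> time_limit X u s x \<longleftrightarrow>
     p \<in> topspace X \<and> (\<forall>U n. openin X U \<longrightarrow> p \<in> U \<longrightarrow> (\<exists>t. n < s * t \<and> u (t, x) \<in> U))"
proof -
  have "(\<exists>y\<in>{u (t, x) | t. n < s * t}. y \<in> U) \<longleftrightarrow> (\<exists>t. n < s * t \<and> u (t, x) \<in> U)" for n U
    by auto
  then show ?thesis
    unfolding time_limit_def in_closure_of INT_iff by blast
qed

lemma time_limit_subset_topspace: "time_limit X u s x \<subseteq> topspace X"
  by (auto simp: in_time_limit_iff)

lemma time_limit_subset_closedin:
  assumes "closedin X B" "\<And>t. u (t, x) \<in> B"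
  shows "time_limit X u s x \<subseteq> B"
proof
  fix p assume p: "p \<in> time_limit X u s x"
  show "p \<in> B"
  proof (rule ccontr)
    assume "p \<notin> B"
    moreover have "openin X (topspace X - B)"
      using assms(1) by blast
    ultimately show False
      using p assms(2) unfolding in_time_limit_iff by (metis DiffD2 DiffI)
  qed
qed

lemma time_limit_subset_closure_orbit: "time_limit X u s x \<subseteq> X closure_of orbit u x"
proof -
  have "{u (t, x) | t. 0 < s * t} \<subseteq> orbit u x"
    by (auto simp: orbit_def)
  then show ?thesis
    unfolding time_limit_def by (meson INT_lower UNIV_I closure_of_mono order_trans)
qed

text \<open>The closures of the tails decrease, so compactness gives a common point. It provides
  aperiodic orbits with a limit point from which their level can be read off.\<close>

lemma time_limit_nonempty:
  assumes u: "flow X u" and X: "compact_space X" and x: "x \<in> topspace X" and s: "s \<noteq> 0"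
  shows "time_limit X u s x \<noteq> {}"
proof -
  define C where "C = (\<lambda>n::nat. X closure_of {u (t, x) | t. real n < s * t})"
  have dec: "decseq C"
    unfolding C_def by (intro decseq_SucI closure_of_mono) auto
  have ne: "C n \<noteq> {}" for n
  proof -
    have "real n < s * ((real n + 1) / s)"
      using s by simp
    then have "u ((real n + 1) / s, x) \<in> {u (t, x) | t. real n < s * t}"
      by blast
    moreover have "{u (t, x) | t. real n < s * t} \<subseteq> C n"
      unfolding C_def using flow_in_topspace [OF u x] by (intro closure_of_subset) auto
    ultimately show ?thesis
      by auto
  qed
  have clo: "closedin X (C n)" for n
    by (simp add: C_def)
  obtain p where p: "\<And>n. p \<in> C n"
    using compact_space_imp_nest [OF X clo ne dec] by blast
  have "p \<in> X closure_of {u (t, x) | t. r < s * t}" for r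
  proof -
    obtain n where "r \<le> real n"
      using real_arch_simple by blast
    then have "{u (t, x) | t. real n < s * t} \<subseteq> {u (t, x) | t. r < s * t}"
      by force
    then show ?thesis
      using p [of n] closure_of_mono unfolding C_def by blast
  qed
  then show ?thesis
    unfolding time_limit_def by blast
qed

lemma compactin_periodic_orbit:
  assumes u: "flow X u" and x: "x \<in> topspace X" and T: "T > 0" "u (T, x) = x"
  shows "compactin X (orbit u x)"
proof -
  have "u (t, x) \<in> (\<lambda>t. u (t, x)) ` {0..T}" for t
  proof -
    define k where "k = \<lfloor>t / T\<rfloor>"
    have "of_int k \<le> t / T" "t / T < of_int k + 1"
      unfolding k_def by linarith+
    then have "t - of_int k * T \<in> {0..T}"
      using T(1) by (auto simp: field_simps)
    moreover have "u (t, x) = u (t - of_int k * T, x)"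
      using flow_add [OF u x, of "t - of_int k * T" "of_int k * T"] flow_int_multiple_period [OF u x T(2), of k]
      by simp
    ultimately show ?thesis
      by blast
  qed
  then have "orbit u x = (\<lambda>t. u (t, x)) ` {0..T}"
    unfolding orbit_eq_range by blast
  moreover have "compactin X ((\<lambda>t. u (t, x)) ` {0..T})"
    using image_compactin [OF _ continuous_map_flow_time [OF u x]] by simp
  ultimately show ?thesis
    by simp
qed

lemma periodic_in_time_limit:
  assumes u: "flow X u" and x: "x \<in> topspace X" and T: "T > 0" "u (T, x) = x" and s: "s \<noteq> 0"
  shows "x \<in> time_limit X u s x"
  unfolding in_time_limit_iff
proof (intro conjI x allI impI)
  fix U and n :: real
  assume U: "openin X U" "x \<in> U"
  obtain k :: int where k: "of_int k > n / (\<bar>s\<bar> * T)"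
    using ex_less_of_int by blast
  define j where "j = (if s > 0 then k else - k)"
  have "n < of_int k * (\<bar>s\<bar> * T)"
    using k s T(1) by (simp add: pos_divide_less_eq)
  also have "\<dots> = s * (of_int j * T)"
    by (simp add: j_def)
  finally have "n < s * (of_int j * T)" .
  moreover have "u (of_int j * T, x) \<in> U"
    using flow_int_multiple_period [OF u x T(2)] U by simp
  ultimately show "\<exists>t. n < s * t \<and> u (t, x) \<in> U"
    by blast
qed

text \<open>A connected subset of the stratum on which the primed limits are constant lies in
  \<open>weak_class'\<close> automatically, so the component within a component reduces to a single
  maximality condition.\<close>

lemma weak_class''_eqI:
  assumes B: "connectedin X B" "x \<in> B" "B \<subseteq> orbit_stratum X u x"
    and lim: "\<And>y. y \<in> B \<Longrightarrow> alpha_limit' X u y = alpha_limit' X u x \<and> omega_limit' X u y = omega_limit' X u x"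
    and max: "\<And>K. connectedin X K \<Longrightarrow> x \<in> K \<Longrightarrow> K \<subseteq> orbit_stratum X u x \<Longrightarrow>
      (\<And>y. y \<in> K \<Longrightarrow> alpha_limit' X u y = alpha_limit' X u x \<and> omega_limit' X u y = omega_limit' X u x) \<Longrightarrow> K \<subseteq> B"
  shows "weak_class'' X u x = B"
proof -
  define A where "A = {y \<in> topspace X. alpha_limit' X u y = alpha_limit' X u x \<and> omega_limit' X u y = omega_limit' X u x}"
  have w': "weak_class' X u x = connected_component_of_set (subtopology X A) x"
    by (simp add: weak_class'_def A_def)
  have "B \<subseteq> A"
    using connectedin_subset_topspace [OF B(1)] lim by (auto simp: A_def)
  then have "B \<subseteq> weak_class' X u x"
    unfolding w' using B by (intro connected_component_of_maximal) (auto simp: connectedin_subtopology)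
  then have 1: "B \<subseteq> weak_class'' X u x"
    unfolding weak_class''_def using B
    by (intro connected_component_of_maximal) (auto simp: connectedin_subtopology)
  define K where "K = weak_class'' X u x"
  have "connectedin (subtopology X (weak_class' X u x \<inter> orbit_stratum X u x)) K"
    unfolding K_def weak_class''_def by (rule connectedin_connected_component_of)
  then have "connectedin X K" "K \<subseteq> weak_class' X u x" "K \<subseteq> orbit_stratum X u x"
    by (auto simp: connectedin_subtopology)
  moreover have "weak_class' X u x \<subseteq> A"
    unfolding w' using connected_component_of_subset_topspace [of "subtopology X A" x] by auto
  moreover have "x \<in> K"
    using 1 B(2) by (auto simp: K_def)
  ultimately have "K \<subseteq> B"
    by (intro max) (auto simp: A_def)
  then show ?thesis
    using 1 by (auto simp: K_def)
qed

text \<open>Everything that enters \<open>weak_orbit\<close> is built from orbits, closures and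
  connected components. Invariance and intertwining therefore suffice for the transport, and the
  suspension on the mapping torus can be compared with a product flow without verifying the flow
  axioms on the torus.\<close>

locale flow_conjugacy =
  fixes X :: "'a topology" and u :: "real \<times> 'a \<Rightarrow> 'a"
    and Y :: "'b topology" and w :: "real \<times> 'b \<Rightarrow> 'b" and h :: "'a \<Rightarrow> 'b"
  assumes hom: "homeomorphic_map X Y h"
    and invariant: "\<And>t x. x \<in> topspace X \<Longrightarrow> u (t, x) \<in> topspace X"
    and conj: "\<And>t x. x \<in> topspace X \<Longrightarrow> h (u (t, x)) = w (t, h x)"
begin

lemma inj: "x \<in> topspace X \<Longrightarrow> y \<in> topspace X \<Longrightarrow> h x = h y \<longleftrightarrow> x = y"
  using homeomorphic_imp_injective_map [OF hom] by (auto simp: inj_on_def)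

lemma image_inj: "A \<subseteq> topspace X \<Longrightarrow> B \<subseteq> topspace X \<Longrightarrow> h ` A = h ` B \<longleftrightarrow> A = B"
  using homeomorphic_imp_injective_map [OF hom] by (meson inj_on_image_eq_iff)

lemma image_mem: "x \<in> topspace X \<Longrightarrow> A \<subseteq> topspace X \<Longrightarrow> h x \<in> h ` A \<longleftrightarrow> x \<in> A"
  using inj by (auto simp: subset_iff)

lemma topspace_image: "topspace Y = h ` topspace X"
  using homeomorphic_imp_surjective_map [OF hom] by simp

lemma orbit_image: "x \<in> topspace X \<Longrightarrow> orbit w (h x) = h ` orbit u x"
  unfolding orbit_eq_range by (simp add: image_image conj)

lemma orbit_topspace: "x \<in> topspace X \<Longrightarrow> orbit u x \<subseteq> topspace X"
  by (auto simp: orbit_def invariant)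

lemma closure_orbit_image: "x \<in> topspace X \<Longrightarrow> Y closure_of orbit w (h x) = h ` (X closure_of orbit u x)"
  using homeomorphic_map_closure_of [OF hom orbit_topspace] by (simp add: orbit_image)

lemma time_limit_image:
  assumes x: "x \<in> topspace X"
  shows "time_limit Y w s (h x) = h ` time_limit X u s x"
proof -
  have "{w (t, h x) | t. n < s * t} = h ` {u (t, x) | t. n < s * t}" for n
    using conj [OF x] by (auto simp: image_def)
  moreover have "Y closure_of h ` {u (t, x) | t. n < s * t} = h ` (X closure_of {u (t, x) | t. n < s * t})" for n
    using invariant [OF x] by (intro homeomorphic_map_closure_of [OF hom]) auto
  ultimately have "time_limit Y w s (h x) = (\<Inter>n. h ` (X closure_of {u (t, x) | t. n < s * t}))"
    unfolding time_limit_def by simp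
  also have "\<dots> = h ` time_limit X u s x"
    unfolding time_limit_def
    by (rule image_INT [OF homeomorphic_imp_injective_map [OF hom], symmetric, where j = 0])
      (auto simp: closure_of_subset_topspace simp del: Collect_const dest: subsetD [OF closure_of_subset_topspace])
  finally show ?thesis .
qed

lemma limit'_image:
  assumes x: "x \<in> topspace X"
  shows "alpha_limit' Y w (h x) = h ` alpha_limit' X u x"
    "omega_limit' Y w (h x) = h ` omega_limit' X u x"
  unfolding alpha_limit'_def omega_limit'_def alpha_limit_eq omega_limit_eq
    time_limit_image [OF x] orbit_image [OF x]
  using inj_on_image_set_diff [OF homeomorphic_imp_injective_map [OF hom], symmetric]
    time_limit_subset_topspace orbit_topspace [OF x] by (metis Diff_subset order_trans)+

lemma stratum_image:
  assumes x: "x \<in> topspace X"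
  shows "h x \<in> Sing Y w \<longleftrightarrow> x \<in> Sing X u" "h x \<in> Per Y w \<longleftrightarrow> x \<in> Per X u"
    "h x \<in> Nonrec Y w \<longleftrightarrow> x \<in> Nonrec X u" "h x \<in> Rec Y w \<longleftrightarrow> x \<in> Rec X u"
proof -
  have eq: "w (t, h x) = h x \<longleftrightarrow> u (t, x) = x" for t
    using conj [OF x] inj [OF invariant [OF x] x] by metis
  have hx: "h x \<in> topspace Y"
    using x by (simp add: topspace_image)
  show S: "h x \<in> Sing Y w \<longleftrightarrow> x \<in> Sing X u"
    using x hx by (simp add: Sing_def eq)
  show P: "h x \<in> Per Y w \<longleftrightarrow> x \<in> Per X u"
    using x hx by (simp add: Per_def eq)
  have R: "recurrent Y w (h x) \<longleftrightarrow> recurrent X u x"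
    unfolding recurrent_def alpha_limit_eq omega_limit_eq time_limit_image [OF x]
    using image_mem [OF x time_limit_subset_topspace] by blast
  show "h x \<in> Nonrec Y w \<longleftrightarrow> x \<in> Nonrec X u" "h x \<in> Rec Y w \<longleftrightarrow> x \<in> Rec X u"
    using x hx by (simp_all add: Nonrec_def Rec_def Cl_def R S P)
qed

lemma orbit_stratum_image:
  assumes "x \<in> topspace X" "y \<in> topspace X"
  shows "h y \<in> orbit_stratum Y w (h x) \<longleftrightarrow> y \<in> orbit_stratum X u x"
  using assms by (simp add: orbit_stratum_def stratum_image)

lemma component_image:
  assumes x: "x \<in> A" "A \<subseteq> topspace X" and B: "B \<subseteq> topspace Y" "\<And>y. y \<in> topspace X \<Longrightarrow> h y \<in> B \<longleftrightarrow> y \<in> A"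
  shows "connected_component_of_set (subtopology Y B) (h x) = h ` connected_component_of_set (subtopology X A) x"
proof -
  have "homeomorphic_map (subtopology X A) (subtopology Y B) h"
    using B by (intro homeomorphic_map_subtopologies_alt [OF hom]) auto
  then show ?thesis
    using x by (intro homeomorphic_map_connected_component_of) auto
qed

lemma weak_class'_image:
  assumes x: "x \<in> topspace X"
  shows "weak_class' Y w (h x) = h ` weak_class' X u x"
proof -
  have sub: "alpha_limit' X u y \<subseteq> topspace X" "omega_limit' X u y \<subseteq> topspace X" for y
    unfolding alpha_limit'_def omega_limit'_def alpha_limit_eq omega_limit_eq
    by (rule order_trans [OF Diff_subset time_limit_subset_topspace])+
  show ?thesis
    unfolding weak_class'_def
    using x by (intro component_image) (auto simp: limit'_image image_inj [OF sub(1) sub(1)] image_inj [OF sub(2) sub(2)] topspace_image)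
qed

lemma weak_class'_subset: "weak_class' X u x \<subseteq> topspace X"
  unfolding weak_class'_def
  using connected_component_of_subset_topspace by fastforce

lemma self_in_weak_class': "x \<in> topspace X \<Longrightarrow> x \<in> weak_class' X u x"
  unfolding weak_class'_def by (simp add: connected_component_of_refl)

lemma weak_class''_image:
  assumes x: "x \<in> topspace X"
  shows "weak_class'' Y w (h x) = h ` weak_class'' X u x"
proof -
  have self: "x \<in> orbit_stratum X u x"
    using x by (auto simp: orbit_stratum_def Nonrec_def Rec_def Cl_def)
  show ?thesis
    unfolding weak_class''_def
  proof (rule component_image)
    show "x \<in> weak_class' X u x \<inter> orbit_stratum X u x"
      using self self_in_weak_class' x by blast
    show "weak_class' X u x \<inter> orbit_stratum X u x \<subseteq> topspace X"
      using weak_class'_subset by blast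
    show "weak_class' Y w (h x) \<inter> orbit_stratum Y w (h x) \<subseteq> topspace Y"
      unfolding weak_class'_image [OF x] topspace_image using weak_class'_subset by blast
    show "h y \<in> weak_class' Y w (h x) \<inter> orbit_stratum Y w (h x) \<longleftrightarrow>
        y \<in> weak_class' X u x \<inter> orbit_stratum X u x" if "y \<in> topspace X" for y
      using that x image_mem [OF that weak_class'_subset]
      by (simp add: weak_class'_image orbit_stratum_image)
  qed
qed

lemma weak_orbit_subset: "weak_orbit X u x \<subseteq> topspace X"
proof -
  have "weak_class'' X u x \<subseteq> topspace X"
    unfolding weak_class''_def using connected_component_of_subset_topspace by fastforce
  then show ?thesis
    by (auto simp: weak_orbit_def)
qed

lemma weak_orbit_image:
  assumes x: "x \<in> topspace X"
  shows "weak_orbit Y w (h x) = h ` weak_orbit X u x"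
proof (cases "x \<in> Rec X u")
  case False
  then show ?thesis
    using x by (simp add: weak_orbit_def stratum_image weak_class''_image)
next
  case True
  have "Y closure_of orbit w (h y) = Y closure_of orbit w (h x) \<longleftrightarrow> X closure_of orbit u y = X closure_of orbit u x"
    "time_limit Y w s (h y) = time_limit Y w s (h x) \<longleftrightarrow> time_limit X u s y = time_limit X u s x"
    if "y \<in> topspace X" for y s
    using that x by (simp_all add: closure_orbit_image time_limit_image image_inj closure_of_subset_topspace time_limit_subset_topspace)
  then have "{y \<in> h ` topspace X. Y closure_of orbit w y = Y closure_of orbit w (h x) \<and>
        time_limit Y w (- 1) y = time_limit Y w (- 1) (h x) \<and> time_limit Y w 1 y = time_limit Y w 1 (h x)} =
      h ` {y \<in> topspace X. X closure_of orbit u y = X closure_of orbit u x \<and>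
        time_limit X u (- 1) y = time_limit X u (- 1) x \<and> time_limit X u 1 y = time_limit X u 1 x}"
    by blast
  then show ?thesis
    using True x unfolding weak_orbit_def alpha_limit_eq omega_limit_eq topspace_image
    by (simp add: stratum_image)
qed

end


section \<open>The product of a flow and a rotation\<close>

text \<open>The covering of the circle by the line with kernel the integers; period one matches the
  gluing of the mapping torus.\<close>

definition turn :: "real \<Rightarrow> complex" where
  "turn t = cis (2 * pi * t)"

lemma turn_add: "turn (s + t) = turn s * turn t"
  by (simp add: turn_def cis_mult algebra_simps)

lemma turn_eq_iff: "turn s = turn t \<longleftrightarrow> (\<exists>k::int. s = t + of_int k)"
proof -
  have "turn s = turn t \<longleftrightarrow> sin (2 * pi * s) = sin (2 * pi * t) \<and> cos (2 * pi * s) = cos (2 * pi * t)"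
    by (auto simp: turn_def complex_eq_iff)
  also have "\<dots> \<longleftrightarrow> (\<exists>k::int. 2 * pi * s = 2 * pi * t + 2 * pi * of_int k)"
    by (rule sin_cos_eq_iff)
  also have "\<dots> \<longleftrightarrow> (\<exists>k::int. s = t + of_int k)"
    by (simp flip: distrib_left)
  finally show ?thesis .
qed

lemma turn_0 [simp]: "turn 0 = 1"
  by (simp add: turn_def)

lemma turn_of_int [simp]: "turn (of_int k) = 1"
  using turn_eq_iff [of "of_int k" 0] by simp

lemma turn_in_circle [simp]: "turn t \<in> sphere 0 1"
  by (simp add: turn_def)

lemma circle_mult: "z \<in> sphere 0 1 \<Longrightarrow> turn t * z \<in> sphere 0 1"
  by (simp add: turn_def norm_mult)

lemma circle_transitive:
  assumes "z \<in> sphere 0 1" "z' \<in> sphere 0 1"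
  obtains t where "z' = turn t * z"
proof -
  have nz: "z \<noteq> 0" and "norm (z' / z) = 1"
    using assms by (auto simp: norm_divide)
  then have "z' / z = turn (Arg (z' / z) / (2 * pi))"
    using rcis_cmod_Arg [of "z' / z"] by (simp add: turn_def rcis_def)
  then show ?thesis
    using that nz by (metis nonzero_eq_divide_eq)
qed

lemma turn_mult_eq_iff:
  assumes "z \<in> sphere 0 1"
  shows "turn t * z = z \<longleftrightarrow> t \<in> \<int>"
proof -
  have "z \<noteq> 0"
    using assms by auto
  then have "turn t * z = z \<longleftrightarrow> turn t = turn 0"
    by simp
  then show ?thesis
    unfolding turn_eq_iff by (auto simp: Ints_def)
qed

lemma continuous_on_turn: "continuous_on S turn"
  unfolding turn_def by (intro continuous_intros)

abbreviation circle :: "complex topology" where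
  "circle \<equiv> top_of_set (sphere 0 1)"

definition product_rotation :: "(real \<times> 'a \<Rightarrow> 'a) \<Rightarrow> real \<times> 'a \<times> complex \<Rightarrow> 'a \<times> complex" where
  "product_rotation v = (\<lambda>(t, y, z). (v (t, y), turn t * z))"

lemma product_rotation_apply: "product_rotation v (t, y, z) = (v (t, y), turn t * z)"
  by (simp add: product_rotation_def)

lemma continuous_map_turn_mult:
  assumes "continuous_map Z euclideanreal f" "continuous_map Z circle g"
  shows "continuous_map Z circle (\<lambda>z. turn (f z) * g z)"
proof -
  have "continuous_map Z euclidean (\<lambda>z. turn (f z))"
    by (rule continuous_map_real_compose [OF assms(1) continuous_on_turn])
  moreover have "continuous_map Z euclidean g"
    using assms(2) continuous_map_into_fulltopology by blast
  ultimately have "continuous_map Z euclidean (\<lambda>z. turn (f z) * g z)"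
    unfolding continuous_map_atin limitin_canonical_iff by (auto intro: tendsto_mult)
  moreover have "turn (f z) * g z \<in> sphere 0 1" if "z \<in> topspace Z" for z
    using assms(2) that by (intro circle_mult) (auto simp: continuous_map_in_subtopology)
  ultimately show ?thesis
    by (auto simp: continuous_map_in_subtopology)
qed

lemma flow_product_rotation:
  assumes v: "flow X v"
  shows "flow (prod_topology X circle) (product_rotation v)"
  unfolding flow_def
proof (intro conjI ballI allI)
  let ?Q = "prod_topology euclideanreal (prod_topology X circle)"
  have snd: "continuous_map ?Q (prod_topology X circle) snd" and fst: "continuous_map ?Q euclideanreal fst"
    by (rule continuous_map_snd continuous_map_fst)+
  have "continuous_map ?Q X (\<lambda>q. fst (snd q))" "continuous_map ?Q circle (\<lambda>q. snd (snd q))"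
    using continuous_map_compose [OF snd continuous_map_fst] continuous_map_compose [OF snd continuous_map_snd]
    by (simp_all add: o_def)
  then have "continuous_map ?Q (prod_topology X circle) (\<lambda>q. (v (fst q, fst (snd q)), turn (fst q) * snd (snd q)))"
    using fst v by (intro continuous_map_pairedI continuous_map_flow_compose continuous_map_turn_mult) auto
  then show "continuous_map ?Q (prod_topology X circle) (product_rotation v)"
    by (simp add: product_rotation_def case_prod_unfold)
  fix p assume p: "p \<in> topspace (prod_topology X circle)"
  then obtain y z where yz: "p = (y, z)" "y \<in> topspace X"
    by auto
  show "product_rotation v (0, p) = p"
    using flow_zero [OF v yz(2)] by (simp add: yz(1) product_rotation_apply)
  show "product_rotation v (s + t, p) = product_rotation v (s, product_rotation v (t, p))" for s t
    using flow_add [OF v yz(2)] by (simp add: yz(1) product_rotation_apply turn_add)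
qed

text \<open>Away from the singular points, the periodic points of the time-one map fill no open set.
  This is what the choice of the exponent \<open>l\<close> secures for the rescaled flow.\<close>

locale nonresonant_level_flow = level_flow +
  assumes nonresonant: "\<And>W. openin X W \<Longrightarrow> W \<noteq> {} \<Longrightarrow> W \<inter> Sing X v = {} \<Longrightarrow>
    \<exists>y\<in>W. \<forall>n>0. v (real n, y) \<noteq> y"
begin

abbreviation "P \<equiv> prod_topology X circle"

abbreviation "u \<equiv> product_rotation v"

text \<open>The points periodic under the time-one map, singular points included; they turn out to
  be the first coordinates of the closed orbits of \<open>u\<close>.\<close>

definition "resonant = {y \<in> topspace X. \<exists>n>0. v (real n, y) = y}"

abbreviation "slab y \<equiv> orbit v y \<times> sphere (0 :: complex) 1"

lemma flow_P: "flow P u"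
  using flow by (rule flow_product_rotation)

lemma Hausdorff_P: "Hausdorff_space P"
  using Hausdorff by (simp add: Hausdorff_space_prod_topology Hausdorff_space_subtopology)

lemma compact_P: "compact_space P"
  using compact by (simp add: compact_space_prod_topology compact_space_subtopology compactin_euclidean_iff)

lemma resonant_orbit:
  assumes y: "y \<in> resonant" and z: "z \<in> orbit v y"
  shows "z \<in> resonant"
proof -
  obtain n where n: "y \<in> topspace X" "n > 0" "v (real n, y) = y"
    using y by (auto simp: resonant_def)
  obtain t where t: "z = v (t, y)"
    using z by (auto simp: in_orbit_iff)
  have "v (real n, z) = v (t, v (real n, y))"
    unfolding t using flow_add [OF flow n(1)] by (simp add: add.commute)
  then have "v (real n, z) = z"
    using n t by simp
  then show ?thesis
    using n t flow_in_topspace [OF flow] by (auto simp: resonant_def)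
qed

lemma connected_resonant_subset_orbit:
  assumes "connectedin X K" "K \<subseteq> resonant" "y \<in> K"
  shows "K \<subseteq> orbit v y"
proof (rule connected_closed_orbits_subset_orbit [OF _ _ _ assms])
  show "\<not> W \<subseteq> resonant" if "openin X W" "W \<noteq> {}" "W \<inter> Sing X v = {}" for W
    using nonresonant [OF that] by (auto simp: resonant_def)
  show "compactin X (orbit v y)" if y: "y \<in> resonant" for y
  proof -
    obtain n where "y \<in> topspace X" "n > 0" "v (real n, y) = y"
      using y by (auto simp: resonant_def)
    then show ?thesis
      using compactin_periodic_orbit [OF flow, of y "real n"] by simp
  qed
qed (rule resonant_orbit)

lemma orbit_P_subset_slab:
  assumes "y \<in> topspace X" "z \<in> sphere 0 1"
  shows "orbit u (y, z) \<subseteq> slab y"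
  using assms circle_mult by (auto simp: orbit_def product_rotation_apply)

lemma connectedin_slab: "y \<in> topspace X \<Longrightarrow> connectedin P (slab y)"
  using connectedin_orbit [OF flow] connected_sphere [of "0 :: complex" 1]
  by (auto simp: connectedin_Times connectedin_subtopology)

lemma connectedin_fst_image: "connectedin P K \<Longrightarrow> connectedin X (fst ` K)"
  using connectedin_continuous_map_image continuous_map_fst by blast

section \<open>Closed orbits of the product flow\<close>

lemma Sing_P: "Sing P u = {}"
proof -
  have False if sing: "p \<in> Sing P u" for p
  proof -
    obtain y z where p: "p = (y, z)" "z \<in> sphere 0 1"
      using Sing_in_topspace [OF sing] by auto
    then have "turn (1 / 2) * z = z"
      using Sing_fixed [OF sing, of "1 / 2"] by (simp add: product_rotation_apply)
    then show False
      using p(2) by (auto simp: turn_def)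
  qed
  then show ?thesis
    by blast
qed

text \<open>The circle coordinate returns only at integer times, so a period of \<open>u\<close> is
  an integer period of \<open>v\<close>; the least positive one is the minimal period that
  \<open>Per\<close> asks for.\<close>

lemma Per_P: "Per P u = resonant \<times> sphere 0 1"
proof (intro subset_antisym subsetI)
  fix p assume "p \<in> Per P u"
  then obtain T where T: "p \<in> topspace P" "T > 0" "u (T, p) = p"
    by (auto simp: Per_def)
  then obtain y z where p: "p = (y, z)" "y \<in> topspace X" "z \<in> sphere 0 1"
    by auto
  have "turn T * z = z" and y: "v (T, y) = y"
    using T(3) by (auto simp: p product_rotation_apply)
  then have "T \<in> \<int>"
    using turn_mult_eq_iff [OF p(3)] by blast
  then obtain k where "T = of_int k"
    by (auto simp: Ints_def)
  then have "T = real (nat k)" "nat k > 0"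
    using T(2) by auto
  then have "y \<in> resonant"
    using p(2) y unfolding resonant_def by (intro CollectI conjI exI [of _ "nat k"]) simp_all
  then show "p \<in> resonant \<times> sphere 0 1"
    using p by simp
next
  fix p assume "p \<in> resonant \<times> sphere (0 :: complex) 1"
  then obtain y z n where p: "p = (y, z)" "y \<in> topspace X" "z \<in> sphere 0 1" "n > 0" "v (real n, y) = y"
    by (auto simp: resonant_def)
  define m where "m = (LEAST n. n > 0 \<and> v (real n, y) = y)"
  have m: "m > 0 \<and> v (real m, y) = y"
    unfolding m_def by (rule LeastI [of _ n]) (use p in blast)
  have "u (t, p) \<noteq> p" if t: "0 < t" "t < real m" for t
  proof
    assume "u (t, p) = p"
    then have "v (t, y) = y" "turn t * z = z"
      by (auto simp: p product_rotation_apply)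
    then obtain k where "t = of_int k"
      using turn_mult_eq_iff [OF p(3)] by (auto simp: Ints_def)
    then have "t = real (nat k)" "nat k > 0" "nat k < m"
      using t by auto
    then show False
      using not_less_Least [of "nat k" "\<lambda>n. n > 0 \<and> v (real n, y) = y"] \<open>v (t, y) = y\<close>
      by (simp add: m_def)
  qed
  moreover have "u (real m, p) = p"
    using m turn_of_int [of "int m"] by (simp add: p product_rotation_apply)
  ultimately show "p \<in> Per P u"
    using p m unfolding Per_def by (intro CollectI conjI exI [of _ "real m"]) auto
qed

text \<open>A closed orbit contains its own limit sets. Hence the primed limits agree on all closed
  orbits, and only connectedness is left to separate them.\<close>

lemma limit'_resonant:
  assumes "p \<in> resonant \<times> sphere 0 1"
  shows "alpha_limit' P u p = {}" "omega_limit' P u p = {}"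
proof -
  have p: "p \<in> topspace P"
    using assms by (auto simp: resonant_def)
  obtain T where "T > 0" "u (T, p) = p"
    using assms Per_P unfolding Per_def by auto
  then have "closedin P (orbit u p)"
    using compactin_imp_closedin [OF Hausdorff_P] compactin_periodic_orbit [OF flow_P p] by blast
  then have "time_limit P u s p \<subseteq> orbit u p" for s
    by (rule time_limit_subset_closedin) (auto simp: orbit_def)
  then show "alpha_limit' P u p = {}" "omega_limit' P u p = {}"
    by (auto simp: alpha_limit'_def omega_limit'_def alpha_limit_eq omega_limit_eq)
qed

text \<open>The slab consists of closed orbits of \<open>u\<close>, merged because it is connected.
  A larger connected set of closed orbits would project to a connected set of resonant points that
  leaves the orbit of \<open>y\<close>, which nonresonance excludes.\<close>

lemma weak_orbit_resonant:
  assumes y: "y \<in> resonant" and z: "z \<in> sphere 0 1"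
  shows "weak_orbit P u (y, z) = slab y"
proof -
  have yX: "y \<in> topspace X"
    using y by (simp add: resonant_def)
  have per: "(y, z) \<in> Per P u"
    using y z by (simp add: Per_P)
  have stratum: "orbit_stratum P u (y, z) = resonant \<times> sphere 0 1"
    using per by (simp add: orbit_stratum_def Sing_P) (simp add: Per_P)
  have slab: "slab y \<subseteq> resonant \<times> sphere 0 1"
    using resonant_orbit [OF y] by auto
  have "weak_class'' P u (y, z) = slab y"
  proof (rule weak_class''_eqI)
    show "(y, z) \<in> slab y"
      using self_in_orbit [OF flow yX] z by simp
    show "alpha_limit' P u p = alpha_limit' P u (y, z) \<and> omega_limit' P u p = omega_limit' P u (y, z)"
      if "p \<in> slab y" for p
    proof -
      have "p \<in> resonant \<times> sphere 0 1" "(y, z) \<in> resonant \<times> sphere 0 1"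
        using that slab y z by auto
      then show ?thesis
        by (simp only: limit'_resonant)
    qed
    show "K \<subseteq> slab y" if K: "connectedin P K" "(y, z) \<in> K" "K \<subseteq> orbit_stratum P u (y, z)" for K
    proof -
      have "fst ` K \<subseteq> orbit v y"
        using K by (intro connected_resonant_subset_orbit connectedin_fst_image)
          (auto simp: stratum intro: image_eqI [of _ fst "(y, z)"])
      then show ?thesis
        using K(3) by (auto simp: stratum)
    qed
  qed (use connectedin_slab [OF yX] slab stratum in auto)
  then show ?thesis
    using per by (simp add: weak_orbit_def Rec_def Cl_def)
qed

section \<open>Orbits of irrational period: minimal tori\<close>

lemma periodic_irrational:
  assumes y: "y \<in> topspace X" "y \<notin> resonant" and T: "T > 0" "v (T, y) = y"
  shows "T \<notin> \<rat>"
proof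
  assume "T \<in> \<rat>"
  then obtain a b :: int where ab: "T = of_int a / of_int b" "b > 0"
    using Rats_cases' by metis
  then have "of_int a = of_int b * T"
    by simp
  moreover have "a > 0"
    using ab T(1) by (simp add: zero_less_divide_iff)
  ultimately have "v (real (nat a), y) = y" "nat a > 0"
    using flow_int_multiple_period [OF flow y(1) T(2), of b] by auto
  then show False
    using y unfolding resonant_def by blast
qed

text \<open>The times \<open>a + j * T\<close> with integer \<open>j\<close> all bring
  \<open>y\<close> to the same point, while their turns are dense in the circle because
  \<open>T\<close> is irrational.\<close>

lemma time_limit_irrational:
  assumes y: "y \<in> topspace X" "y \<notin> resonant" and T: "T > 0" "v (T, y) = y"
    and z: "z \<in> sphere 0 1" and s: "s = 1 \<or> s = - 1"
  shows "time_limit P u s (y, z) = slab y"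
proof
  have "closedin X (orbit v y)"
    using compactin_imp_closedin [OF Hausdorff] compactin_periodic_orbit [OF flow y(1) T] by blast
  then have "closedin P (slab y)"
    by (simp add: closedin_prod_Times_iff)
  then show "time_limit P u s (y, z) \<subseteq> slab y"
    using orbit_P_subset_slab [OF y(1) z] unfolding orbit_eq_range
    by (intro time_limit_subset_closedin) (simp_all add: image_subset_iff)
next
  have irr: "s * T \<notin> \<rat>"
    using periodic_irrational [OF y T] s by auto
  show "slab y \<subseteq> time_limit P u s (y, z)"
  proof (rule subsetI)
    fix p assume "p \<in> slab y"
    then obtain y' z' where p: "p = (y', z')" "y' \<in> orbit v y" "z' \<in> sphere 0 1"
      by auto
    then obtain a where a: "y' = v (a, y)"
      by (auto simp: in_orbit_iff)
    obtain b where b: "z' = turn b * z"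
      using circle_transitive [OF z p(3)] by blast
    have y'X: "y' \<in> topspace X"
      using a flow_in_topspace [OF flow y(1)] by simp
    show "p \<in> time_limit P u s (y, z)"
      unfolding in_time_limit_iff
    proof (intro conjI allI impI)
      show "p \<in> topspace P"
        using p y'X by simp
      fix U and n :: real
      assume U: "openin P U" "p \<in> U"
      have "continuous_map euclideanreal P (\<lambda>\<theta>. (y', turn \<theta> * z))"
        using y'X z by (intro continuous_map_pairedI continuous_map_turn_mult) auto
      then have "open {\<theta>. (y', turn \<theta> * z) \<in> U}"
        using openin_continuous_map_preimage [OF _ U(1), of euclideanreal] by simp
      moreover have "b \<in> {\<theta>. (y', turn \<theta> * z) \<in> U}"
        using U(2) by (simp add: p b)
      ultimately obtain e where e: "e > 0" "\<And>\<theta>. \<bar>\<theta> - b\<bar> < e \<Longrightarrow> (y', turn \<theta> * z) \<in> U"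
        unfolding open_dist dist_real_def by blast
      \<comment> \<open>The density result gives only \<open>k > 0\<close>; \<open>K\<close>
        additional periods push \<open>s * t\<close> beyond \<open>n\<close>, and their phase is
        subtracted from the target.\<close>
      obtain K :: nat where K: "real K > (n - s * a) / T"
        using reals_Archimedean2 by blast
      obtain h k :: int where k: "k > 0"
          "\<bar>of_int k * (s * T) - of_int h - (b - a - s * real K * T)\<bar> < e"
        using sequence_of_fractional_parts_is_dense [OF irr e(1)] by metis
      define t where "t = a + s * (of_int k + real K) * T"
      have "s * s = 1"
        using s by auto
      then have "s * t = s * a + (of_int k + real K) * T"
        by (simp add: t_def distrib_left mult.assoc [symmetric])
      moreover have "n - s * a < real K * T"
        using K T(1) by (simp add: pos_divide_less_eq)
      moreover have "of_int k * T > 0"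
        using k(1) T(1) by simp
      ultimately have "n < s * t"
        by (simp add: distrib_right)
      moreover have "u (t, (y, z)) \<in> U"
      proof -
        obtain j :: int where j: "t = a + of_int j * T"
          using s that [of "k + int K"] that [of "- (k + int K)"] by (auto simp: t_def)
        have "v (t, y) = y'"
          using flow_add [OF flow y(1), of a "of_int j * T"] flow_int_multiple_period [OF flow y(1) T(2), of j]
          by (simp add: j a)
        moreover have "turn t = turn (t - of_int h)"
          unfolding turn_eq_iff by (intro exI [of _ h]) simp
        moreover have "\<bar>t - of_int h - b\<bar> < e"
          using k(2) by (simp add: t_def algebra_simps)
        ultimately show ?thesis
          using e(2) by (simp add: product_rotation_apply)
      qed
      ultimately show "\<exists>t. n < s * t \<and> u (t, (y, z)) \<in> U"
        by blast
    qed
  qed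
qed

text \<open>Every orbit in the slab is dense in it in both time directions, so the three sets
  compared at recurrent points all equal the slab. Conversely a point lies in the closure of its own
  orbit, which keeps all other points out.\<close>

lemma weak_orbit_irrational:
  assumes y: "y \<in> topspace X" "y \<notin> resonant" and T: "T > 0" "v (T, y) = y" and z: "z \<in> sphere 0 1"
  shows "weak_orbit P u (y, z) = slab y"
proof -
  have lim: "time_limit P u s p = slab y" "P closure_of orbit u p = slab y"
    if p: "p \<in> slab y" and s: "s = 1 \<or> s = - 1" for p s
  proof -
    obtain y' z' t where p': "p = (y', z')" "y' = v (t, y)" "z' \<in> sphere 0 1"
      using p by (auto simp: in_orbit_iff)
    have y': "y' \<in> topspace X" "orbit v y' = orbit v y"
      using p' flow_in_topspace [OF flow y(1)] orbit_eq [OF flow y(1)] by (auto simp: in_orbit_iff)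
    have "y' \<notin> resonant"
      using resonant_orbit y' y self_in_orbit [OF flow y(1)] by metis
    moreover have "v (T, y') = y'"
      using flow_add [OF flow y(1), of T t] flow_add [OF flow y(1), of t T] T(2) p'(2) by (simp add: add.commute)
    ultimately show *: "time_limit P u s p = slab y"
      using time_limit_irrational [OF y'(1) _ T(1) _ p'(3) s] y'(2) p'(1) by simp
    have "closedin X (orbit v y)"
      using compactin_imp_closedin [OF Hausdorff] compactin_periodic_orbit [OF flow y(1) T] by blast
    then have "closedin P (slab y)"
      by (simp add: closedin_prod_Times_iff)
    moreover have "orbit u p \<subseteq> slab y"
      using orbit_P_subset_slab [OF y'(1) p'(3)] p'(1) y'(2) by simp
    ultimately have "P closure_of orbit u p \<subseteq> slab y"
      by (simp add: closure_of_minimal)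
    then show "P closure_of orbit u p = slab y"
      using * time_limit_subset_closure_orbit [of P u s p] by blast
  qed
  have yz: "(y, z) \<in> slab y"
    using self_in_orbit [OF flow y(1)] z by simp
  have "(y, z) \<in> omega_limit P u (y, z)"
    using lim(1) [OF yz, of 1] yz by (simp add: omega_limit_eq)
  then have rec: "(y, z) \<in> Rec P u"
    using y z by (auto simp: Rec_def recurrent_def Cl_def Sing_P Per_P)
  have in_slab: "q \<in> slab y" if "q \<in> topspace P" "P closure_of orbit u q = slab y" for q
  proof -
    have "q \<in> P closure_of orbit u q"
      using closure_of_subset [OF orbit_subset_topspace [OF flow_P that(1)]] self_in_orbit [OF flow_P that(1)] by blast
    then show ?thesis
      using that by simp
  qed
  have sub: "slab y \<subseteq> topspace P"
    using orbit_subset_topspace [OF flow y(1)] by auto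
  have "q \<in> topspace P \<and> P closure_of orbit u q = slab y \<and>
      time_limit P u (- 1) q = slab y \<and> time_limit P u 1 q = slab y \<longleftrightarrow> q \<in> slab y" for q
    using in_slab [of q] subsetD [OF sub, of q] lim(1) [of q 1] lim(1) [of q "- 1"] lim(2) [of q 1] by blast
  then show ?thesis
    using rec lim(1) [OF yz] lim(2) [OF yz, of 1]
    unfolding weak_orbit_def alpha_limit_eq omega_limit_eq by simp
qed

section \<open>Aperiodic orbits\<close>

lemma time_limit_aperiodic:
  assumes y: "y \<in> topspace X" "\<And>t. v (t, y) = y \<Longrightarrow> t = 0" and s: "s = 1 \<or> s = - 1"
    and p: "p \<in> time_limit P u s (y, z)"
  shows "fst p \<in> Sing X v" "H (fst p) = H y"
proof -
  have pX: "fst p \<in> topspace X" "snd p \<in> sphere 0 1"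
    using p time_limit_subset_topspace by force+
  have "\<exists>t. \<bar>t\<bar> > n \<and> v (t, y) \<in> U" if U: "openin X U" "fst p \<in> U" for U and n :: real
  proof -
    have "openin P (U \<times> sphere 0 1)" "p \<in> U \<times> sphere 0 1"
      using U pX(2) by (auto simp: openin_prod_Times_iff mem_Times_iff)
    then obtain t where "\<bar>n\<bar> < s * t" "u (t, (y, z)) \<in> U \<times> sphere 0 1"
      using p unfolding in_time_limit_iff by metis
    then show ?thesis
      using s by (intro exI [of _ t]) (auto simp: product_rotation_apply)
  qed
  then show "fst p \<in> Sing X v" "H (fst p) = H y"
    using limit_point_in_Sing [OF y pX(1)] by blast+
qed

text \<open>The limit set consists of singular points, which \<open>v\<close> fixes; so it is invariant under both
  \<open>v\<close> and the rotation.\<close>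

lemma time_limit_aperiodic_slab_subset:
  assumes y: "y \<in> topspace X" "\<And>t. v (t, y) = y \<Longrightarrow> t = 0" and s: "s = 1 \<or> s = - 1"
    and z: "z \<in> sphere 0 1" and q: "q \<in> slab y"
  shows "time_limit P u s (y, z) \<subseteq> time_limit P u s q"
proof
  fix p assume p: "p \<in> time_limit P u s (y, z)"
  obtain a where a: "fst q = v (a, y)"
    using q by (auto simp: in_orbit_iff)
  have "snd q \<in> sphere 0 1"
    using q by auto
  then obtain b where b: "snd q = turn b * z"
    using circle_transitive [OF z] by blast
  \<comment> \<open>Up to the displacement \<open>a - b\<close> in the first factor,
    \<open>q\<close> is the time \<open>b\<close> translate of \<open>(y, z)\<close>.
    \<open>F\<close> performs this displacement: it carries one orbit to the other with a time shift
    \<open>b\<close> and fixes \<open>p\<close>, whose first coordinate is singular.\<close>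
  define F where "F = (\<lambda>r :: 'a \<times> complex. (v (a - b, fst r), snd r))"
  have "continuous_map P P F"
    unfolding F_def
    using continuous_map_compose [OF continuous_map_fst continuous_map_flow_space [OF flow]]
    by (intro continuous_map_pairedI continuous_map_snd) (simp add: o_def)
  have Fp: "F p = p"
    using Sing_fixed [OF time_limit_aperiodic(1) [OF y s p]] by (simp add: F_def)
  have F: "F (u (t, (y, z))) = u (t - b, q)" for t
  proof -
    have "q = (v (a, y), turn b * z)"
      using a b by (simp add: prod_eq_iff)
    moreover have "turn t = turn (t - b) * turn b"
      by (simp flip: turn_add)
    ultimately show ?thesis
      using flow_add [OF flow y(1)] by (simp add: F_def product_rotation_apply algebra_simps)
  qed
  show "p \<in> time_limit P u s q"
    unfolding in_time_limit_iff
  proof (intro conjI allI impI)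
    show "p \<in> topspace P"
      by (rule subsetD [OF time_limit_subset_topspace p])
    fix U and n :: real
    assume U: "openin P U" "p \<in> U"
    have "openin P {r \<in> topspace P. F r \<in> U}"
      using \<open>continuous_map P P F\<close> U(1) by (rule openin_continuous_map_preimage)
    moreover have "p \<in> {r \<in> topspace P. F r \<in> U}"
      using U(2) Fp \<open>p \<in> topspace P\<close> by simp
    ultimately have "\<exists>t. n + s * b < s * t \<and> u (t, (y, z)) \<in> {r \<in> topspace P. F r \<in> U}"
      using p [unfolded in_time_limit_iff] by (elim conjE allE impE)
    then obtain t where "n + s * b < s * t" "u (t, (y, z)) \<in> {r \<in> topspace P. F r \<in> U}"
      by blast
    then have "n < s * (t - b)" "u (t - b, q) \<in> U"
      using F by (auto simp: right_diff_distrib)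
    then show "\<exists>t. n < s * t \<and> u (t, q) \<in> U"
      by blast
  qed
qed

lemma aperiodic_orbit:
  assumes y: "y \<in> topspace X" "\<And>t. v (t, y) = y \<Longrightarrow> t = 0" and x: "x \<in> orbit v y"
    and t: "v (t, x) = x"
  shows "t = 0"
proof -
  obtain a where a: "x = v (a, y)"
    using x by (auto simp: in_orbit_iff)
  have "v (t, y) = v (- a, v (t, x))"
    unfolding a flow_add [OF flow y(1)] by simp
  also have "\<dots> = y"
    using flow_inverse [OF flow y(1), of a] by (simp only: t a [symmetric])
  finally show ?thesis
    by (rule y(2))
qed

text \<open>The points \<open>q\<close> and \<open>(y, z)\<close> lie in each other's slab, so the
  inclusion just proved can be used in both directions.\<close>

lemma time_limit_aperiodic_slab:
  assumes y: "y \<in> topspace X" "\<And>t. v (t, y) = y \<Longrightarrow> t = 0" and s: "s = 1 \<or> s = - 1"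
    and z: "z \<in> sphere 0 1" and q: "q \<in> slab y"
  shows "time_limit P u s q = time_limit P u s (y, z)"
proof
  show "time_limit P u s (y, z) \<subseteq> time_limit P u s q"
    by (rule time_limit_aperiodic_slab_subset [OF y s z q])
  have q1: "fst q \<in> orbit v y" "snd q \<in> sphere 0 1"
    using q by auto
  then have qX: "fst q \<in> topspace X"
    using orbit_subset_topspace [OF flow y(1)] by blast
  have "(y, z) \<in> slab (fst q)"
    using orbit_eq [OF flow y(1) q1(1)] self_in_orbit [OF flow y(1)] z by simp
  from time_limit_aperiodic_slab_subset [OF qX aperiodic_orbit [OF y q1(1)] s q1(2) this]
  show "time_limit P u s q \<subseteq> time_limit P u s (y, z)"
    by simp
qed

text \<open>The limit sets lie over singular points, of which the orbit of \<open>y\<close> contains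
  none. So they are disjoint from the slab, and removing the orbit in the primed sets changes
  nothing.\<close>

lemma aperiodic_Nonrec:
  assumes y: "y \<in> topspace X" "\<And>t. v (t, y) = y \<Longrightarrow> t = 0" and z: "z \<in> sphere 0 1"
  shows "(y, z) \<in> Nonrec P u"
    "alpha_limit' P u (y, z) = time_limit P u (- 1) (y, z)" "omega_limit' P u (y, z) = time_limit P u 1 (y, z)"
proof -
  have ns: "x \<notin> Sing X v" if "x \<in> orbit v y" for x
  proof
    assume "x \<in> Sing X v"
    then have "v (1, x) = x"
      by (rule Sing_fixed)
    from aperiodic_orbit [OF y that this] show False
      by simp
  qed
  have disj: "q \<notin> slab y" if "q \<in> time_limit P u s (y, z)" "s = 1 \<or> s = - 1" for q s
    using time_limit_aperiodic(1) [OF y that(2,1)] ns by auto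
  have yz: "(y, z) \<in> slab y" "(y, z) \<in> topspace P"
    using self_in_orbit [OF flow y(1)] y z by auto
  show "(y, z) \<in> Nonrec P u"
    using disj yz by (auto simp: Nonrec_def recurrent_def alpha_limit_eq omega_limit_eq)
  show "alpha_limit' P u (y, z) = time_limit P u (- 1) (y, z)" "omega_limit' P u (y, z) = time_limit P u 1 (y, z)"
    using disj orbit_P_subset_slab [OF y(1) z] unfolding alpha_limit'_def omega_limit'_def alpha_limit_eq omega_limit_eq
    by blast+
qed

text \<open>A nonzero period of \<open>y\<close> makes \<open>(y, z)\<close> a point of its own
  \<omega>-limit set, as a closed orbit in the resonant case and by minimality of the torus
  otherwise.\<close>

lemma Nonrec_aperiodic:
  assumes q: "(y, z) \<in> Nonrec P u" and t: "v (t, y) = y"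
  shows "t = 0"
proof (rule ccontr)
  assume "t \<noteq> 0"
  have y: "y \<in> topspace X" "z \<in> sphere 0 1" "(y, z) \<in> topspace P"
    using q by (auto simp: Nonrec_def)
  have "v (\<bar>t\<bar>, y) = y"
    using t flow_inverse [OF flow y(1), of t] by (auto simp: abs_if)
  have "(y, z) \<in> time_limit P u 1 (y, z)"
  proof (cases "y \<in> resonant")
    case True
    then have "(y, z) \<in> Per P u"
      using y by (simp add: Per_P)
    then show ?thesis
      using periodic_in_time_limit [OF flow_P y(3)] unfolding Per_def by auto
  next
    case False
    then show ?thesis
      using time_limit_irrational [OF y(1) False _ \<open>v (\<bar>t\<bar>, y) = y\<close> y(2), of 1] \<open>t \<noteq> 0\<close>
        self_in_orbit [OF flow y(1)] y(2) by simp
  qed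
  then show False
    using q by (simp add: Nonrec_def recurrent_def omega_limit_eq)
qed

text \<open>A common limit set pins down the level: its points carry the level of every orbit that
  has it as limit. A connected set of nonrecurrent points with this limit set therefore projects
  into the nonsingular part of one level, where connectedness confines it to one orbit.\<close>

lemma weak_orbit_aperiodic:
  assumes y: "y \<in> topspace X" "\<And>t. v (t, y) = y \<Longrightarrow> t = 0" and z: "z \<in> sphere 0 1"
  shows "weak_orbit P u (y, z) = slab y"
proof -
  have nonrec: "(y, z) \<in> Nonrec P u"
    by (rule aperiodic_Nonrec(1) [OF y z])
  have "y \<notin> resonant"
    using y(2) [of "real _"] by (auto simp: resonant_def)
  then have "(y, z) \<notin> Per P u"
    by (simp add: Per_P)
  then have stratum: "orbit_stratum P u (y, z) = Nonrec P u"
    using nonrec by (simp add: orbit_stratum_def Sing_P)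
  have slabE: "q \<in> Nonrec P u \<and> alpha_limit' P u q = time_limit P u (- 1) (y, z) \<and>
      omega_limit' P u q = time_limit P u 1 (y, z)" if q: "q \<in> slab y" for q
  proof -
    have q1: "fst q \<in> orbit v y" "snd q \<in> sphere 0 1"
      using q by auto
    then have qX: "fst q \<in> topspace X"
      using orbit_subset_topspace [OF flow y(1)] by blast
    show ?thesis
      using aperiodic_Nonrec [OF qX aperiodic_orbit [OF y q1(1)] q1(2)]
        time_limit_aperiodic_slab [OF y _ z q, of 1] time_limit_aperiodic_slab [OF y _ z q, of "- 1"]
      by simp
  qed
  have "weak_class'' P u (y, z) = slab y"
  proof (rule weak_class''_eqI)
    show yz: "(y, z) \<in> slab y"
      using self_in_orbit [OF flow y(1)] z by simp
    show "connectedin P (slab y)"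
      by (rule connectedin_slab [OF y(1)])
    show "slab y \<subseteq> orbit_stratum P u (y, z)"
      using slabE stratum by blast
    show "alpha_limit' P u q = alpha_limit' P u (y, z) \<and> omega_limit' P u q = omega_limit' P u (y, z)"
      if "q \<in> slab y" for q
      using slabE [OF that] slabE [OF yz] by simp
    show "K \<subseteq> slab y"
      if K: "connectedin P K" "(y, z) \<in> K" "K \<subseteq> orbit_stratum P u (y, z)"
        and lim: "\<And>q. q \<in> K \<Longrightarrow> alpha_limit' P u q = alpha_limit' P u (y, z) \<and> omega_limit' P u q = omega_limit' P u (y, z)"
      for K
    proof -
      have KP: "K \<subseteq> topspace P"
        using K(1) connectedin_subset_topspace by blast
      have "x \<notin> Sing X v \<and> H x = H y" if x: "x \<in> fst ` K" for x
      proof -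
        obtain c where c: "(x, c) \<in> K"
          using x by force
        then have xc: "x \<in> topspace X" "c \<in> sphere 0 1" "(x, c) \<in> Nonrec P u"
          using KP K(3) stratum by auto
        have ap: "t = 0" if "v (t, x) = x" for t
          by (rule Nonrec_aperiodic [OF xc(3) that])
        have "time_limit P u (- 1) (x, c) = time_limit P u (- 1) (y, z)"
          using lim [OF c] aperiodic_Nonrec(2) [OF xc(1) ap xc(2)] aperiodic_Nonrec(2) [OF y z] by simp
        \<comment> \<open>Compactness enters here: with an empty limit set, equality of limit sets
          would say nothing about levels.\<close>
        moreover obtain p where p: "p \<in> time_limit P u (- 1) (x, c)"
          using time_limit_nonempty [OF flow_P compact_P, of "(x, c)" "- 1"] xc by auto
        ultimately have "H x = H y"
          using time_limit_aperiodic(2) [OF xc(1) ap _ p] time_limit_aperiodic(2) [OF y, of "- 1" p z] by simp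
        moreover have "x \<notin> Sing X v"
          using ap [of 1] Sing_fixed [of x X v 1] by auto
        ultimately show ?thesis
          by blast
      qed
      moreover have "y \<in> fst ` K"
        using K(2) by force
      ultimately have "fst ` K \<subseteq> orbit v y"
        using connected_regular_level_subset_orbit [OF connectedin_fst_image [OF K(1)]] by blast
      then show ?thesis
        using KP by force
    qed
  qed
  moreover have "(y, z) \<notin> Rec P u"
    using nonrec by (auto simp: Rec_def Nonrec_def)
  ultimately show ?thesis
    by (simp add: weak_orbit_def)
qed

lemma weak_orbit_product_rotation:
  assumes y: "y \<in> topspace X" and z: "z \<in> sphere 0 1"
  shows "weak_orbit P u (y, z) = slab y"
proof -
  consider "y \<in> resonant" | T where "y \<notin> resonant" "T \<noteq> 0" "v (T, y) = y" | "\<And>t. v (t, y) = y \<Longrightarrow> t = 0"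
    by blast
  then show ?thesis
  proof cases
    case 1
    then show ?thesis
      using z by (rule weak_orbit_resonant)
  next
    case 2
    then have "v (\<bar>T\<bar>, y) = y"
      using flow_inverse [OF flow y, of T] by (auto simp: abs_if)
    then show ?thesis
      using 2 y z by (intro weak_orbit_irrational [of _ "\<bar>T\<bar>"]) auto
  next
    case 3
    then show ?thesis
      using y z by (intro weak_orbit_aperiodic)
  qed
qed

end


section \<open>The suspension of a time-one map\<close>

lemma int_iterate_time_one:
  assumes w: "flow X w" and x: "x \<in> topspace X"
  shows "int_iterate X (\<lambda>x. w (1, x)) n x = w (of_int n, x)"
proof -
  let ?f = "\<lambda>x. w (1, x)" and ?g = "inv_into (topspace X) (\<lambda>x. w (1, x))"
  have pos: "(?f ^^ k) x = w (real k, x)" for k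
    using flow_zero [OF w x] flow_add [OF w x] by (induction k) auto
  have g: "?g y = w (- 1, y)" if y: "y \<in> topspace X" for y
  proof -
    have "w (1, w (- 1, y)) = y"
      using flow_inverse [OF w y, of "- 1"] by simp
    then show ?thesis
      by (rule inv_into_f_eq [OF homeomorphic_imp_injective_map [OF homeomorphic_map_flow [OF w]]
            flow_in_topspace [OF w y]])
  qed
  have neg: "(?g ^^ k) x = w (- real k, x)" for k
  proof (induction k)
    case (Suc k)
    have "- real (Suc k) = - 1 + - real k"
      by simp
    then show ?case
      by (simp only: funpow.simps o_apply Suc g [OF flow_in_topspace [OF w x]] flow_add [OF w x])
  qed (simp add: flow_zero [OF w x])
  show ?thesis
    using pos [of "nat n"] neg [of "nat (- n)"] by (simp add: int_iterate_def)
qed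

lemma torus_class_time_one:
  assumes "flow X w" "x \<in> topspace X"
  shows "torus_class X (\<lambda>x. w (1, x)) (x, t) = {(w (of_int n, x), t - of_int n) | n. True}"
  using int_iterate_time_one [OF assms] by (simp add: torus_class_def)

text \<open>\<open>(w (t, x), turn t)\<close> does not change when \<open>(x, t)\<close> is replaced
  by \<open>(w (n, x), t - n)\<close> with integer \<open>n\<close>; it is the coordinate that
  straightens the mapping torus to a product.\<close>

lemma torus_class_eq_iff:
  assumes w: "flow X w" and x: "x \<in> topspace X" and y: "y \<in> topspace X"
  shows "torus_class X (\<lambda>x. w (1, x)) (x, t) = torus_class X (\<lambda>x. w (1, x)) (y, s) \<longleftrightarrow>
    w (t, x) = w (s, y) \<and> turn t = turn s"
proof
  assume "torus_class X (\<lambda>x. w (1, x)) (x, t) = torus_class X (\<lambda>x. w (1, x)) (y, s)"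
  also have "(y, s) \<in> \<dots>"
    unfolding torus_class_time_one [OF w y]
    by (intro CollectI exI [of _ 0]) (simp add: flow_zero [OF w y])
  finally obtain n where "y = w (of_int n, x)" "s = t - of_int n"
    by (auto simp: torus_class_time_one [OF w x])
  then show "w (t, x) = w (s, y) \<and> turn t = turn s"
    by (auto simp: flow_add [OF w x] turn_eq_iff)
next
  assume eq: "w (t, x) = w (s, y) \<and> turn t = turn s"
  then obtain k where k: "t = s + of_int k"
    by (auto simp: turn_eq_iff)
  have "y = w (- s, w (t, x))"
    using eq flow_inverse [OF w y] by simp
  then have yk: "y = w (of_int k, x)"
    using flow_add [OF w x] k by simp
  have "(w (of_int n, x), t - of_int n) = (w (of_int (n - k), y), s - of_int (n - k))" for n
    using flow_add [OF w x] by (simp add: yk k)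
  then show "torus_class X (\<lambda>x. w (1, x)) (x, t) = torus_class X (\<lambda>x. w (1, x)) (y, s)"
    unfolding torus_class_time_one [OF w x] torus_class_time_one [OF w y]
    by (metis (no_types, opaque_lifting) add_diff_cancel)
qed

text \<open>A time-one map is isotopic to the identity, so its mapping torus is \<open>X \<times> S\<^sup>1\<close>.\<close>

lemma mapping_torus_time_one:
  assumes w: "flow X w" and X: "compact_space X" "Hausdorff_space X"
  obtains \<Phi> where
    "flow_conjugacy (mapping_torus X (\<lambda>x. w (1, x))) suspension_flow (prod_topology X circle) (product_rotation w) \<Phi>"
    "\<And>x t. x \<in> topspace X \<Longrightarrow> \<Phi> (torus_class X (\<lambda>x. w (1, x)) (x, t)) = (w (t, x), turn t)"
proof -
  let ?q = "torus_class X (\<lambda>x. w (1, x))" and ?M = "mapping_torus X (\<lambda>x. w (1, x))"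
  let ?P = "prod_topology X circle"
  define F where "F = (\<lambda>(x, t). (w (t, x), turn t))"
  have q: "quotient_map (prod_topology X euclideanreal) ?M ?q"
    unfolding mapping_torus_def by (rule quotient_map_quotient_topology)
  have "continuous_map (prod_topology X euclideanreal) circle (\<lambda>p. turn (snd p) * 1)"
    by (intro continuous_map_turn_mult continuous_map_snd) auto
  then have "continuous_map (prod_topology X euclideanreal) ?P (\<lambda>p. (w (snd p, fst p), turn (snd p)))"
    using w by (intro continuous_map_pairedI continuous_map_flow_compose continuous_map_fst continuous_map_snd) auto
  then have "continuous_map (prod_topology X euclideanreal) ?P F"
    by (simp add: F_def case_prod_unfold)
  moreover have qF: "?q a = ?q b \<longleftrightarrow> F a = F b"
    if ab: "a \<in> topspace (prod_topology X euclideanreal)" "b \<in> topspace (prod_topology X euclideanreal)" for a b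
  proof -
    obtain x t y s where "a = (x, t)" "b = (y, s)" "x \<in> topspace X" "y \<in> topspace X"
      using ab by auto
    then show ?thesis
      using torus_class_eq_iff [OF w] by (simp add: F_def)
  qed
  ultimately obtain \<Phi> where \<Phi>: "continuous_map ?M ?P \<Phi>"
      "\<Phi> ` topspace ?M = F ` topspace (prod_topology X euclideanreal)"
      "\<And>a. a \<in> topspace (prod_topology X euclideanreal) \<Longrightarrow> \<Phi> (?q a) = F a"
    using quotient_map_lift_exists [OF q] by metis
  have M: "topspace ?M = ?q ` (topspace X \<times> UNIV)"
    by (simp add: mapping_torus_def)
  have "inj_on \<Phi> (topspace ?M)"
    unfolding M using \<Phi>(3) qF by (auto simp: inj_on_def)
  moreover have "F ` topspace (prod_topology X euclideanreal) = topspace ?P"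
  proof -
    have "p \<in> F ` (topspace X \<times> UNIV)" if p: "p \<in> topspace ?P" for p
    proof -
      obtain y z where yz: "p = (y, z)" "y \<in> topspace X" "z \<in> sphere 0 1"
        using p by auto
      obtain t where t: "z = turn t * 1"
        using circle_transitive [of 1 z] yz(3) by auto
      have "p = F (w (- t, y), t)"
        using flow_inverse [OF w yz(2), of "- t"] t yz by (simp add: F_def)
      then show ?thesis
        using flow_in_topspace [OF w yz(2)] by blast
    qed
    moreover have "F ` (topspace X \<times> UNIV) \<subseteq> topspace ?P"
      using flow_in_topspace [OF w] turn_in_circle by (auto simp: F_def simp del: mem_sphere_0)
    ultimately show ?thesis
      by auto
  qed
  \<comment> \<open>Each class has a representative with second coordinate in \<open>{0..1}\<close>,
    so the torus is the image of a compact set; the continuous bijection onto a Hausdorff space is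
    then a homeomorphism.\<close>
  moreover have "compact_space ?M"
  proof -
    have "c \<in> ?q ` (topspace X \<times> {0..1})" if cM: "c \<in> topspace ?M" for c
    proof -
      obtain x t where c: "c = ?q (x, t)" "x \<in> topspace X"
        using cM M by auto
      define k where "k = \<lfloor>t\<rfloor>"
      have "w (t, x) = w (t - of_int k, w (of_int k, x))" "turn t = turn (t - of_int k)"
        by (auto simp: flow_add [OF w c(2)] turn_eq_iff)
      then have "c = ?q (w (of_int k, x), t - of_int k)"
        unfolding c(1) using torus_class_eq_iff [OF w c(2) flow_in_topspace [OF w c(2)]] by simp
      moreover have "t - of_int k \<in> {0..1}"
        by (simp add: k_def) linarith
      ultimately show ?thesis
        using flow_in_topspace [OF w c(2)] by blast
    qed
    moreover have "?q ` (topspace X \<times> {0..1}) \<subseteq> topspace ?M"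
      unfolding M by auto
    moreover have "compactin (prod_topology X euclideanreal) (topspace X \<times> {0..1})"
      using X(1) by (simp add: compactin_Times compact_space_def)
    then have "compactin ?M (?q ` (topspace X \<times> {0..1}))"
      using image_compactin quotient_imp_continuous_map [OF q] by blast
    ultimately show ?thesis
      unfolding compact_space_def by (metis subset_antisym subsetI)
  qed
  moreover have "Hausdorff_space ?P"
    using X(2) by (simp add: Hausdorff_space_prod_topology Hausdorff_space_subtopology)
  ultimately have "homeomorphic_map ?M ?P \<Phi>"
    using \<Phi> by (intro continuous_imp_homeomorphic_map) auto
  moreover have \<Phi>q: "\<Phi> (?q (x, t)) = (w (t, x), turn t)" if "x \<in> topspace X" for x t
    using \<Phi>(3) [of "(x, t)"] that by (simp add: F_def)
  moreover have "suspension_flow (t, c) \<in> topspace ?M \<and>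
      \<Phi> (suspension_flow (t, c)) = product_rotation w (t, \<Phi> c)" if c: "c \<in> topspace ?M" for t c
  proof -
    obtain x s where x: "c = ?q (x, s)" "x \<in> topspace X"
      using c M by auto
    then show ?thesis
      using \<Phi>q M flow_add [OF w x(2)] by (simp add: suspension_flow_torus_class product_rotation_apply turn_add)
  qed
  ultimately have "flow_conjugacy ?M suspension_flow ?P (product_rotation w) \<Phi>"
    by unfold_locales auto
  then show ?thesis
    using that \<Phi>q by blast
qed

text \<open>The class of \<open>(y, 0)\<close> has product coordinates \<open>(y, 1)\<close>, and
  the slice of \<open>slab x\<close> over \<open>1\<close> is the orbit of \<open>x\<close>.\<close>

lemma (in nonresonant_level_flow) map_weak_orbit_time_one:
  assumes x: "x \<in> topspace X"
  shows "map_weak_orbit X (\<lambda>x. v (1, x)) x = orbit v x"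
proof -
  let ?q = "torus_class X (\<lambda>x. v (1, x))"
  obtain \<Phi> where conj: "flow_conjugacy (mapping_torus X (\<lambda>x. v (1, x))) suspension_flow P u \<Phi>"
    and \<Phi>: "\<And>x t. x \<in> topspace X \<Longrightarrow> \<Phi> (?q (x, t)) = (v (t, x), turn t)"
    using mapping_torus_time_one [OF flow compact Hausdorff] by blast
  interpret c: flow_conjugacy "mapping_torus X (\<lambda>x. v (1, x))" suspension_flow P u \<Phi>
    by (rule conj)
  have q: "?q (y, 0) \<in> topspace (mapping_torus X (\<lambda>x. v (1, x)))" "\<Phi> (?q (y, 0)) = (y, 1)"
    if "y \<in> topspace X" for y
    using that \<Phi> flow_zero [OF flow] by (auto simp: mapping_torus_def)
  let ?W = "weak_orbit (mapping_torus X (\<lambda>x. v (1, x))) suspension_flow (?q (x, 0))"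
  have W: "\<Phi> ` ?W = slab x"
    using c.weak_orbit_image [OF q(1) [OF x]] weak_orbit_product_rotation [OF x, of 1] q(2) [OF x] by simp
  have "?q (y, 0) \<in> ?W \<longleftrightarrow> y \<in> orbit v x" if y: "y \<in> topspace X" for y
  proof -
    have "?W \<subseteq> topspace (mapping_torus X (\<lambda>x. v (1, x)))"
      by (rule c.weak_orbit_subset)
    then have "?q (y, 0) \<in> ?W \<longleftrightarrow> \<Phi> (?q (y, 0)) \<in> \<Phi> ` ?W"
      using c.image_mem [OF q(1) [OF y]] by blast
    then show ?thesis
      using q(2) [OF y] W by simp
  qed
  then show ?thesis
    unfolding map_weak_orbit_def using orbit_subset_topspace [OF flow x] by blast
qed


section \<open>Small reparametrizations\<close>

text \<open>Joint continuity in time, point and \<open>l\<close> yields continuity in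
  \<open>l\<close> for the compact-open topology, by the tube lemma along a compact
  \<open>K\<close>. Thus every neighbourhood of \<open>v\<close> contains the rescaled flows with
  \<open>l\<close> close to 0.\<close>

lemma continuous_map_rescale_family:
  assumes v: "flow X v" and cont: "continuous_map X euclideanreal H"
    and inv: "\<And>x t. x \<in> topspace X \<Longrightarrow> H (v (t, x)) = H x"
  shows "continuous_map euclideanreal (flow_topology X) (\<lambda>l. rescale (\<lambda>x. l * H x) v)"
proof -
  let ?Q = "prod_topology euclideanreal X"
  let ?\<gamma> = "\<lambda>l. rescale (\<lambda>x. l * H x) v"
  have fl: "flow X (?\<gamma> l)" for l
    using cont inv by (intro flow_rescale v continuous_map_real_mult_left) auto
  define G where "G = (\<lambda>((t, x), l). ?\<gamma> l (t, x))"
  have G: "continuous_map (prod_topology ?Q euclideanreal) X G"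
  proof -
    let ?R = "prod_topology ?Q euclideanreal"
    have l: "continuous_map ?R euclideanreal snd"
      by (rule continuous_map_snd)
    have t: "continuous_map ?R euclideanreal (\<lambda>r. fst (fst r))" and x: "continuous_map ?R X (\<lambda>r. snd (fst r))"
      using continuous_map_compose [OF continuous_map_fst continuous_map_fst, of euclideanreal X euclideanreal]
        continuous_map_compose [OF continuous_map_fst continuous_map_snd, of euclideanreal X euclideanreal]
      by (simp_all add: o_def)
    have "continuous_map ?R euclideanreal (\<lambda>r. H (snd (fst r)))"
      using continuous_map_compose [OF x cont] by (simp add: o_def)
    then have "continuous_map ?R euclideanreal (\<lambda>r. snd r * H (snd (fst r)))"
      using l by (intro continuous_map_real_mult)
    then have "continuous_map ?R euclideanreal (\<lambda>r. exp (snd r * H (snd (fst r))))"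
      by (rule continuous_map_real_compose) (intro continuous_intros)
    then have "continuous_map ?R euclideanreal (\<lambda>r. exp (snd r * H (snd (fst r))) * fst (fst r))"
      using t by (rule continuous_map_real_mult)
    from continuous_map_flow_compose [OF v this x] show ?thesis
      by (simp add: G_def rescale_def case_prod_unfold)
  qed
  have pre: "openin euclideanreal {l. ?\<gamma> l ` K \<subseteq> U}" if K: "compactin ?Q K" and U: "openin X U" for K U
  proof (subst openin_subopen, intro ballI)
    fix l assume l: "l \<in> {l. ?\<gamma> l ` K \<subseteq> U}"
    let ?W = "{r \<in> topspace (prod_topology ?Q euclideanreal). G r \<in> U}"
    have "openin (prod_topology ?Q euclideanreal) ?W"
      by (rule openin_continuous_map_preimage [OF G U])
    moreover have "K \<times> {l} \<subseteq> ?W"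
      using l compactin_subset_topspace [OF K] by (auto simp: G_def)
    ultimately obtain A V where AV: "openin euclideanreal V" "K \<subseteq> A" "l \<in> V" "A \<times> V \<subseteq> ?W"
      using tube_lemma_left [OF _ K, of euclideanreal ?W l] by auto
    have "V \<subseteq> {l. ?\<gamma> l ` K \<subseteq> U}"
      using AV by (fastforce simp: G_def)
    then show "\<exists>T. openin euclideanreal T \<and> l \<in> T \<and> T \<subseteq> {l. ?\<gamma> l ` K \<subseteq> U}"
      using AV by blast
  qed
  have cm: "continuous_map ?Q X (?\<gamma> l)" for l
    by (rule flow_continuous_map [OF fl])
  have "continuous_map euclideanreal (compact_open_topology ?Q X) ?\<gamma>"
    unfolding compact_open_topology_def continuous_on_generated_topo_iff
  proof (intro conjI allI impI)
    fix \<U> assume "\<U> \<in> {{f. continuous_map ?Q X f \<and> f ` K \<subseteq> U} | K U. compactin ?Q K \<and> openin X U}"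
    then obtain K U where KU: "compactin ?Q K" "openin X U" "\<U> = {f. continuous_map ?Q X f \<and> f ` K \<subseteq> U}"
      by blast
    then have "?\<gamma> -` \<U> \<inter> topspace euclideanreal = {l. ?\<gamma> l ` K \<subseteq> U}"
      using cm by auto
    then show "openin euclideanreal (?\<gamma> -` \<U> \<inter> topspace euclideanreal)"
      using pre [OF KU(1,2)] by simp
  next
    \<comment> \<open>With \<open>K = {}\<close> the subbasic set consists of all continuous maps,
      so the subbasis covers the whole family.\<close>
    have "{f. continuous_map ?Q X f \<and> f ` {} \<subseteq> {}} \<in>
        {{f. continuous_map ?Q X f \<and> f ` K \<subseteq> U} | K U. compactin ?Q K \<and> openin X U}"
      using compactin_empty openin_empty by blast
    then show "?\<gamma> ` topspace euclideanreal \<subseteq>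
        \<Union> {{f. continuous_map ?Q X f \<and> f ` K \<subseteq> U} | K U. compactin ?Q K \<and> openin X U}"
      using cm by blast
  qed
  then show ?thesis
    unfolding flow_topology_def continuous_map_in_subtopology using fl by auto
qed

lemma quotient_topology_cong:
  assumes "\<And>x. x \<in> topspace X \<Longrightarrow> q x = q' x"
  shows "quotient_topology X q = quotient_topology X q'"
proof -
  have "q ` topspace X = q' ` topspace X"
    using assms by (rule image_cong [OF refl])
  moreover have "{x \<in> topspace X. q x \<in> V} = {x \<in> topspace X. q' x \<in> V}" for V
    using assms by auto
  ultimately show ?thesis
    by (simp add: topology_eq openin_quotient_topology)
qed

theorem theorem11p2:
  fixes S :: "'a topology" and v :: "real \<times> 'a \<Rightarrow> 'a" and N :: "(real \<times> 'a \<Rightarrow> 'a) set"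
  assumes "surface S" and "compact_space S"
    and "hamiltonian_flow S v" and "finite (Sing S v)"
    and "openin (flow_topology S) N" and "v \<in> N"
  shows "\<exists>w\<in>N. reparametrization S v w \<and>
           orbit_space S v homeomorphic_space map_weak_orbit_space S (\<lambda>x. w (1, x))"
proof -
  have S: "Hausdorff_space S" "second_countable S"
    using assms(1) by (auto simp: surface_def)
  have v: "flow S v"
    using assms(3) by (simp add: hamiltonian_flow_def)
  obtain H where H: "continuous_map S euclideanreal H"
    "\<And>t x. x \<in> topspace S \<Longrightarrow> H (v (t, x)) = H x"
    "\<And>x. x \<in> topspace S \<Longrightarrow> x \<notin> Sing S v \<Longrightarrow> level_box S v H x"
    using hamiltonian_flow_level_structure [OF S(1) assms(3)] by blast
  have lf: "level_flow S v H"
    using v assms S H by unfold_locales auto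
  let ?w = "\<lambda>l. rescale (\<lambda>x. l * H x) v"
  have "open {l. ?w l \<in> N}"
    using openin_continuous_map_preimage [OF continuous_map_rescale_family [OF v H(1,2)] assms(5)] by simp
  \<comment> \<open>At \<open>l = 0\<close> the factor is 1 and the rescaled flow is
    \<open>v\<close> itself, as a function.\<close>
  moreover have "?w 0 \<in> N"
    using assms(6) by (simp add: rescale_def)
  ultimately obtain d where d: "d > 0" "ball 0 d \<subseteq> {l. ?w l \<in> N}"
    by (metis mem_Collect_eq open_contains_ball)
  define L where "L = {l. \<exists>W. openin S W \<and> W \<noteq> {} \<and> W \<inter> Sing S v = {} \<and>
    (\<forall>y\<in>W. \<exists>n>0. v (exp (l * H y) * real n, y) = y)}"
  have "countable L"
    unfolding L_def by (rule level_flow.countable_resonant_exponents [OF lf S(2)])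
  \<comment> \<open>An interval is uncountable, so arbitrarily small exponents outside the countable
    exceptional set exist.\<close>
  then have "\<not> {0<..<d} \<subseteq> L"
    using d(1) uncountable_open_interval countable_subset by blast
  then obtain l where l: "l \<in> {0<..<d}" "l \<notin> L"
    by blast
  interpret w: nonresonant_level_flow S "?w l" H
  proof (intro nonresonant_level_flow.intro nonresonant_level_flow_axioms.intro)
    show "level_flow S (?w l) H"
      by (rule level_flow_rescale [OF lf])
    show "\<exists>y\<in>W. \<forall>n>0. ?w l (real n, y) \<noteq> y" if "openin S W" "W \<noteq> {}" "W \<inter> Sing S (?w l) = {}" for W
    proof (rule ccontr)
      assume "\<not> ?thesis"
      then have "l \<in> L"
        unfolding L_def using that by (intro CollectI exI [of _ W]) (auto simp: Sing_rescale rescale_apply)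
      then show False
        using l(2) by blast
    qed
  qed
  have orb: "map_weak_orbit S (\<lambda>x. ?w l (1, x)) x = orbit v x" if "x \<in> topspace S" for x
    using w.map_weak_orbit_time_one [OF that] by (simp add: orbit_rescale)
  \<comment> \<open>The two partitions of \<open>S\<close> coincide, so the quotient spaces are
    equal and the identity is the homeomorphism.\<close>
  have "orbit_space S v = map_weak_orbit_space S (\<lambda>x. ?w l (1, x))"
    unfolding orbit_space_def map_weak_orbit_space_def
    by (rule quotient_topology_cong) (simp add: orb)
  moreover have "reparametrization S v (?w l)"
    using w.flow by (simp add: reparametrization_def orbit_rescale)
  moreover have "?w l \<in> N"
    using subsetD [OF d(2), of l] l(1) by (simp add: dist_real_def)
  ultimately show ?thesis
    using homeomorphic_space_refl by metis
qed

end
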